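(* Let $\|\cdot\|_T$ and $\|\cdot\|_D$ be norms on $\mathbb{R}^2$ with $\|p\|_D\le\|p\|_T$ for all $p\in\mathbb{R}^2$, and let $\mathsf{TSPD}(\cdot)$ be the associated optimal TSPD makespan functional on finite subsets of $\mathbb{R}^2$. If $X_1,X_2,\ldots$ are independent and uniformly distributed in $[0,1]^2$, then there exists a (deterministic) constant $\beta_{\mathsf{TSPD}}$ such that $$\lim_{n\to\infty}\frac{\mathsf{TSPD}(\{X_1,\ldots,X_n\})}{\sqrt n}=\beta_{\mathsf{TSPD}}\quad\text{almost surely.}$$
   Context: Traveling Salesman Problem with Drone (TSPD). Let $\|\cdot\|_T$ (truck metric) and $\|\cdot\|_D$ (drone metric) be norms on $\mathbb{R}^2$, and let $\mathcal X\subset\mathbb{R}^2$ be a finite set of customer points (nodes). In a solution each node is exactly one of: a truck node (visited only by the truck), a drone node (served only by the drone), or a combined node (visited by both vehicles; a synchronization point). A ring $r$ is given by two distinct combined nodes serving as start and end nodes, together with at most one drone node and any number (possibly zero) of truck nodes between them. In ring $r$ the truck follows a path $\mathcal T_r$ from the start node through all truck nodes of the ring (in some order) to the end node, and, if a drone node is present, the drone follows the path $\mathcal D_r$ from the start node to the drone node to the end node. With $t(\mathcal T_r)$ the sum of the $\|\cdot\|_T$-lengths of the edges of $\mathcal T_r$ and $d(\mathcal D_r)$ the sum of the $\|\cdot\|_D$-lengths of the edges of $\mathcal D_r$, the cost $c(r)$ of the ring is the minimum, over the choices of $\mathcal T_r,\mathcal D_r$, of $\max\{t(\mathcal T_r),d(\mathcal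 D_r)\}$ if the ring contains a drone node, and of $t(\mathcal T_r)$ otherwise. A feasible solution for $\mathcal X$ is a set $\mathcal R(\mathcal X)$ of rings that together cover all points of $\mathcal X$ and are concatenated through their combined nodes to form a single cyclic tour; each point of $\mathcal X$ is served exactly once: a combined node is shared by exactly two adjacent rings, and every other point belongs to exactly one ring. The optimal makespan is $\mathsf{TSPD}(\mathcal X)=\min_{\mathcal R(\mathcal X)}\sum_{r\in\mathcal R(\mathcal X)}c(r)$. Conventions: $\mathsf{TSPD}(\mathcal X)=0$ if $|\mathcal X|\le1$, and $\mathsf{TSPD}(\{x,y\})=2\|x-y\|_T$ for $x\ne y$. *)

theory Defs
  imports "HOL-Probability.Probability" "HOL-Combinatorics.Multiset_Permutations"
begin

definition is_norm :: "('a::real_vector \<Rightarrow> real) \<Rightarrow> bool" where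
  "is_norm N \<longleftrightarrow>
     (\<forall>x. 0 \<le> N x) \<and> (\<forall>x. N x = 0 \<longleftrightarrow> x = 0) \<and>
     (\<forall>c x. N (c *\<^sub>R x) = \<bar>c\<bar> * N x) \<and>
     (\<forall>x y. N (x + y) \<le> N x + N y)"

fun path_length :: "('a::real_vector \<Rightarrow> real) \<Rightarrow> 'a list \<Rightarrow> real" where
  "path_length N (x # y # zs) = N (y - x) + path_length N (y # zs)"
| "path_length N _ = 0"

datatype drone_ring =
  Ring (start_node: "real^2") (end_node: "real^2")
       (truck_nodes: "(real^2) set") (drone_node: "(real^2) option")

definition inner_nodes :: "drone_ring \<Rightarrow> (real^2) set" where
  "inner_nodes r = truck_nodes r \<union> set_option (drone_node r)"

definition is_ring :: "drone_ring \<Rightarrow> bool" where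
  "is_ring r \<longleftrightarrow>
     start_node r \<noteq> end_node r \<and> finite (truck_nodes r) \<and>
     {start_node r, end_node r} \<inter> inner_nodes r = {} \<and>
     truck_nodes r \<inter> set_option (drone_node r) = {}"

definition truck_paths :: "drone_ring \<Rightarrow> (real^2) list set" where
  "truck_paths r =
     (\<lambda>xs. start_node r # xs @ [end_node r]) ` permutations_of_set (truck_nodes r)"

definition ring_cost ::
  "(real^2 \<Rightarrow> real) \<Rightarrow> (real^2 \<Rightarrow> real) \<Rightarrow> drone_ring \<Rightarrow> real" where
  "ring_cost T D r = Min ((\<lambda>p. case drone_node r of
       None \<Rightarrow> path_length T p
     | Some d \<Rightarrow> max (path_length T p) (path_length D [start_node r, d, end_node r]))
     ` truck_paths r)"

text \<open>
  The rings are listed in the order in which the cyclic tour traverses them: each ring ends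
  where its cyclic successor starts, and no combined node is started from twice. Hence the
  combined nodes are exactly the start nodes, and each of them lies on exactly two rings,
  which are adjacent. Rings are oriented, so a tour through only two combined nodes consists
  of two different rings even if neither has inner nodes.
\<close>

definition cyclic_tour :: "drone_ring set \<Rightarrow> bool" where
  "cyclic_tour R \<longleftrightarrow> (\<exists>rs. rs \<noteq> [] \<and> set rs = R \<and> distinct (map start_node rs) \<and>
     map end_node rs = rotate1 (map start_node rs))"

definition feasible_solution :: "(real^2) set \<Rightarrow> drone_ring set \<Rightarrow> bool" where
  "feasible_solution X R \<longleftrightarrow>
     (\<forall>r\<in>R. is_ring r) \<and> cyclic_tour R \<and>
     X = start_node ` R \<union> (\<Union>r\<in>R. inner_nodes r) \<and>
     (\<forall>r\<in>R. inner_nodes r \<inter> start_node ` R = {}) \<and>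
     disjoint_family_on inner_nodes R"

text \<open>
  The convention for two points needs no separate case, see \<open>TSPD_pair\<close> below.
\<close>

definition TSPD :: "(real^2 \<Rightarrow> real) \<Rightarrow> (real^2 \<Rightarrow> real) \<Rightarrow> (real^2) set \<Rightarrow> real" where
  "TSPD T D X = (if card X \<le> 1 then 0
     else Min ((\<lambda>R. \<Sum>r\<in>R. ring_cost T D r) ` {R. feasible_solution X R}))"

text \<open>The minima above range over finite nonempty sets.\<close>

lemma truck_paths_finite_nonempty:
  assumes "is_ring r"
  shows "finite (truck_paths r)" "truck_paths r \<noteq> {}"
  using assms by (auto simp: truck_paths_def is_ring_def)

lemma cyclic_tour_end_nodes: "cyclic_tour R \<Longrightarrow> end_node ` R = start_node ` R"
  unfolding cyclic_tour_def by (metis list.set_map set_rotate1)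

lemma finite_feasible_solutions:
  assumes "finite X"
  shows "finite {R. feasible_solution X R}"
proof -
  let ?S = "(\<lambda>(a, b, t, d). Ring a b t d) `
    (X \<times> X \<times> Pow X \<times> (insert None (Some ` X)))"
  have "R \<subseteq> ?S" if f: "feasible_solution X R" for R
  proof
    fix r assume r: "r \<in> R"
    have X: "X = start_node ` R \<union> (\<Union>r\<in>R. inner_nodes r)"
      and e: "end_node ` R = start_node ` R"
      using f cyclic_tour_end_nodes by (auto simp: feasible_solution_def)
    have "start_node r \<in> X" "end_node r \<in> X" "inner_nodes r \<subseteq> X"
      using r e X by blast+
    then show "r \<in> ?S"
      by (cases r; cases "drone_node r") (auto simp: inner_nodes_def image_iff)
  qed
  then have "{R. feasible_solution X R} \<subseteq> Pow ?S" by blast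
  moreover have "finite (Pow ?S)" using assms by simp
  ultimately show ?thesis by (rule finite_subset)
qed

lemma feasible_solution_exists:
  assumes "finite X" "1 < card X"
  shows "\<exists>R. feasible_solution X R"
proof -
  obtain x y where xy: "x \<in> X" "y \<in> X" "x \<noteq> y"
    using assms by (metis card_le_Suc0_iff_eq One_nat_def not_le)
  let ?r = "Ring x y (X - {x, y}) None" and ?s = "Ring y x {} None"
  have "cyclic_tour {?r, ?s}"
    unfolding cyclic_tour_def by (rule exI[of _ "[?r, ?s]"]) (use xy in auto)
  then have "feasible_solution X {?r, ?s}"
    using xy assms(1)
    by (auto simp: feasible_solution_def is_ring_def inner_nodes_def disjoint_family_on_def)
  then show ?thesis by blast
qed

lemma feasible_solution_pair:
  assumes "x \<noteq> y"
  shows "feasible_solution {x, y} R \<longleftrightarrow> R = {Ring x y {} None, Ring y x {} None}"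
proof
  assume f: "feasible_solution {x, y} R"
  then have X: "{x, y} = start_node ` R \<union> (\<Union>r\<in>R. inner_nodes r)"
    and ring: "\<And>r. r \<in> R \<Longrightarrow> is_ring r" and c: "cyclic_tour R"
    and inn: "\<And>r. r \<in> R \<Longrightarrow> inner_nodes r \<inter> start_node ` R = {}"
    by (auto simp: feasible_solution_def)
  note e = cyclic_tour_end_nodes[OF c]
  obtain r where r: "r \<in> R" using c by (force simp: cyclic_tour_def)
  have "start_node r \<noteq> end_node r" using ring[OF r] by (simp add: is_ring_def)
  moreover have "start_node r \<in> start_node ` R" "end_node r \<in> start_node ` R" using r e by blast+
  moreover have "start_node ` R \<subseteq> {x, y}" using X by blast
  ultimately have s: "start_node ` R = {x, y}" by blast
  have form: "q = Ring x y {} None \<or> q = Ring y x {} None" if q: "q \<in> R" for q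
  proof -
    have "inner_nodes q \<subseteq> {x, y}" using X q by blast
    then have "inner_nodes q = {}" using inn[OF q] s by auto
    moreover have "start_node q \<in> {x, y}" "end_node q \<in> {x, y}" using q s e by blast+
    moreover have "start_node q \<noteq> end_node q" using ring[OF q] by (simp add: is_ring_def)
    ultimately show ?thesis
      by (cases q; cases "drone_node q") (auto simp: inner_nodes_def)
  qed
  moreover obtain p q where pq: "p \<in> R" "start_node p = x" "q \<in> R" "start_node q = y"
    using s by (metis imageE insertCI)
  then have "p = Ring x y {} None" "q = Ring y x {} None"
    using assms form[of p] form[of q] by (metis drone_ring.sel(1))+
  ultimately show "R = {Ring x y {} None, Ring y x {} None}"
    using pq(1,3) by blast
next
  assume R: "R = {Ring x y {} None, Ring y x {} None}"
  have "cyclic_tour R"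
    unfolding cyclic_tour_def R
    by (rule exI[of _ "[Ring x y {} None, Ring y x {} None]"]) (use assms in auto)
  then show "feasible_solution {x, y} R"
    using assms unfolding R
    by (auto simp: feasible_solution_def is_ring_def inner_nodes_def disjoint_family_on_def)
qed

lemma TSPD_pair:
  assumes "is_norm T" "x \<noteq> y"
  shows "TSPD T D {x, y} = 2 * T (x - y)"
proof -
  have "T (y - x) = T ((-1) *\<^sub>R (x - y))" by simp
  also have "\<dots> = T (x - y)" using assms(1) by (simp only: is_norm_def)
  finally have "T (y - x) = T (x - y)" .
  moreover have "{R. feasible_solution {x, y} R} = {{Ring x y {} None, Ring y x {} None}}"
    using feasible_solution_pair[OF assms(2)] by blast
  ultimately show ?thesis
    using assms(2) by (simp add: TSPD_def ring_cost_def truck_paths_def)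
qed

end

theory Submission
  imports Defs "HOL-Real_Asymp.Real_Asymp"
begin

text \<open>The optimal makespan is replaced, up to an additive constant, by the cost \<open>opt\<close> of an optimal
  open tour. This functional is homogeneous and translation invariant, merging two tours costs at
  most a constant, and deleting a set \<open>F\<close> of points is possible without increasing the cost if up to
  \<open>2 * card F\<close> further points are dropped along with it. The dropped points are reinserted by a short
  tour, so \<open>opt\<close> changes by at most \<open>L * sqrt k\<close> when \<open>k\<close> points are inserted or deleted. Splitting the
  square into \<open>m\<^sup>2\<close> cells then gives \<open>avg (m\<^sup>2 * l) \<le> m * (avg l + C * sqrt (sqrt l))\<close> for the means,
  whence \<open>avg n / sqrt n\<close> converges.

  Bounded differences do not give concentration directly, since a single point may change \<open>opt\<close> by
  a constant. But \<open>opt\<close> is within \<open>L\<^sup>2 / (4 * c)\<close> of a functional that changes by at most \<open>2 * c\<close> per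
  point. With \<open>c\<close> of order \<open>1 / sqrt n\<close>, McDiarmid's inequality gives exponentially small
  deviation probabilities on the scale \<open>sqrt n\<close>, and the Borel--Cantelli lemma finishes the proof.\<close>

section \<open>Open plans\<close>

text \<open>Open plans concatenate at the price of one link and exist for every finite set of nodes,
  including the empty or one-point sets that occur in sparsely filled cells, whereas a closed tour
  needs two combined nodes. The term \<open>sqrt (sqrt l)\<close> measures random occupancy: a cell
  that receives each of \<open>m\<^sup>2 * l\<close> points with probability
  \<open>1 / m\<^sup>2\<close> holds \<open>l\<close> points up to a fluctuation of order
  \<open>sqrt l\<close>, which smoothness turns into a cost of order \<open>sqrt (sqrt l)\<close>.
  Instead of a Poisson number of points, all assignments of the points to cells are summed. The
  error \<open>L\<^sup>2 / (4 * c)\<close> is the maximum of \<open>L * t - c * t\<^sup>2\<close>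
  with \<open>t = sqrt k\<close>. For \<open>c\<close> of order \<open>1 / sqrt n\<close> it is a
  multiple of \<open>sqrt n\<close>, while the squares of the \<open>n\<close> differences have a
  bounded sum; hence deviations of order \<open>sqrt n\<close> have probabilities exponentially
  small in \<open>n\<close>.\<close>

text \<open>Each entry of a plan is a ring without its end node: the combined node at which it starts, its
  truck nodes in the order of their visit, and its drone node. It ends where the next ring starts; the
  last one ends at the node in the list \<open>es\<close> below or, if \<open>es = []\<close>, stays open. Nodes are indices
  that a function \<open>x\<close> maps to points, so coinciding points need no attention and all functionals are
  measurable in \<open>x\<close>.\<close>

type_synonym 'i plan = "('i \<times> 'i list \<times> 'i option) list"

definition seg_nodes :: "'i \<times> 'i list \<times> 'i option \<Rightarrow> 'i list" where
  "seg_nodes s = (case s of (a, ts, d) \<Rightarrow> a # ts @ (case d of None \<Rightarrow> [] | Some p \<Rightarrow> [p]))"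

definition plan_nodes :: "'i plan \<Rightarrow> 'i list" where
  "plan_nodes g = concat (map seg_nodes g)"

fun next_start :: "'i plan \<Rightarrow> 'i list \<Rightarrow> 'i list" where
  "next_start [] es = es"
| "next_start (s # g) es = [fst s]"

definition plans :: "'i set \<Rightarrow> 'i plan set" where
  "plans I = {g. distinct (plan_nodes g) \<and> set (plan_nodes g) = I}"

lemma plan_nodes_simps [simp]:
  "plan_nodes [] = []"
  "plan_nodes (s # g) = seg_nodes s @ plan_nodes g"
  "plan_nodes (g @ g') = plan_nodes g @ plan_nodes g'"
  by (simp_all add: plan_nodes_def)

lemma seg_nodes_simps [simp]:
  "seg_nodes (a, ts, None) = a # ts"
  "seg_nodes (a, ts, Some p) = a # ts @ [p]"
  by (simp_all add: seg_nodes_def)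

lemma fst_in_seg_nodes: "fst s \<in> set (seg_nodes s)"
  by (cases s) (simp add: seg_nodes_def)

lemma next_start_append: "next_start (g @ g') es = next_start g (next_start g' es)"
  by (cases g) auto

lemma finite_plans:
  assumes "finite I"
  shows "finite (plans I)"
proof -
  let ?L = "{xs. set xs \<subseteq> I \<and> length xs \<le> card I}"
  let ?S = "I \<times> ?L \<times> insert None (Some ` I)"
  have "plans I \<subseteq> {g. set g \<subseteq> ?S \<and> length g \<le> card I}"
  proof
    fix g assume g: "g \<in> plans I"
    have len: "length g \<le> length (plan_nodes g)" for g :: "'a plan"
      by (induction g) (auto simp: seg_nodes_def split: prod.splits)
    have c: "length (plan_nodes g) = card I"
      using g by (auto simp: plans_def distinct_card)
    have "s \<in> ?S" if s: "s \<in> set g" for s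
    proof -
      obtain g1 g2 where "g = g1 @ s # g2" using s by (meson split_list)
      then have "set (seg_nodes s) \<subseteq> I" "length (seg_nodes s) \<le> card I"
        using g c by (auto simp: plans_def)
      then show ?thesis
        by (cases s) (auto simp: seg_nodes_def split: option.splits)
    qed
    then show "g \<in> {g. set g \<subseteq> ?S \<and> length g \<le> card I}"
      using len[of g] c by auto
  qed
  moreover have "finite ?S" using assms finite_lists_length_le by blast
  then have "finite {g. set g \<subseteq> ?S \<and> length g \<le> card I}" by (rule finite_lists_length_le)
  ultimately show ?thesis by (rule finite_subset)
qed

lemma plans_nonempty:
  assumes "finite I"
  shows "plans I \<noteq> {}"
proof -
  obtain xs where xs: "set xs = I" "distinct xs" using finite_distinct_list[OF assms] by blast
  show ?thesis
  proof (cases xs)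
    case Nil
    then have "[] \<in> plans I" using xs by (simp add: plans_def)
    then show ?thesis by blast
  next
    case (Cons a ts)
    then have "[(a, ts, None)] \<in> plans I" using xs by (auto simp: plans_def)
    then show ?thesis by blast
  qed
qed

lemma path_length_append:
  "path_length N (xs @ a # ys) = path_length N (xs @ [a]) + path_length N (a # ys)"
  by (induction N xs rule: path_length.induct) auto

lemma path_length_append_eq:
  "xs \<noteq> [] \<Longrightarrow> path_length N (xs @ a # ys) = path_length N xs + N (a - last xs) + path_length N (a # ys)"
  by (induction N xs rule: path_length.induct) auto

lemma path_length_nonneg:
  assumes "\<And>v. 0 \<le> N v"
  shows "0 \<le> path_length N xs"
  by (induction xs rule: induct_list012) (use assms in auto)

section \<open>The two norms and the cost of a plan\<close>

locale truck_drone =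
  fixes T D :: "real^2 \<Rightarrow> real"
  assumes norm_T: "is_norm T" and norm_D: "is_norm D" and D_le_T: "D p \<le> T p"
begin

lemma T_nonneg [simp]: "0 \<le> T v" and D_nonneg [simp]: "0 \<le> D v"
  and T_scale: "T (c *\<^sub>R v) = \<bar>c\<bar> * T v" and D_scale: "D (c *\<^sub>R v) = \<bar>c\<bar> * D v"
  and T_zero [simp]: "T 0 = 0" and D_zero [simp]: "D 0 = 0"
  and T_add: "T (v + w) \<le> T v + T w" and D_add: "D (v + w) \<le> D v + D w"
  using norm_T norm_D by (auto simp: is_norm_def)

lemma T_minus: "T (- v) = T v"
  using T_scale[of "-1" v] by simp

lemma T_commute: "T (v - w) = T (w - v)"
  using T_minus[of "v - w"] by simp

lemma T_triangle: "T (u - w) \<le> T (u - v) + T (v - w)"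
  using T_add[of "u - v" "v - w"] by simp

lemma path_length_T_nonneg [simp]: "0 \<le> path_length T xs"
  and path_length_D_nonneg [simp]: "0 \<le> path_length D xs"
  by (simp_all add: path_length_nonneg)

lemma path_length_T_delete: "path_length T (xs @ ys) \<le> path_length T (xs @ a # ys)"
proof (cases "xs = []"; cases ys)
  fix b zs assume "xs \<noteq> []" "ys = b # zs"
  then show ?thesis
    using T_triangle[of b "last xs" a] by (simp add: path_length_append_eq T_commute)
next
  assume "xs \<noteq> []" "ys = []"
  then show ?thesis by (simp add: path_length_append_eq)
qed (use T_nonneg in \<open>simp_all\<close>)

text \<open>A Lipschitz constant of \<open>T\<close> for the maximum norm, hence a bound for the
  \<open>T\<close>-diameter of the unit square. By \<open>D_le_T\<close> it serves for
  \<open>D\<close> as well.\<close>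

definition B :: real where "B = T (axis 1 1) + T (axis 2 1)"

lemma B_pos: "0 < B"
proof -
  have "T (axis 1 1) \<noteq> 0"
    using norm_T by (simp add: is_norm_def axis_eq_0_iff)
  then show ?thesis
    using T_nonneg[of "axis 1 1"] T_nonneg[of "axis 2 1"] unfolding B_def by linarith
qed

lemma T_le:
  assumes "\<And>k. \<bar>v $ k\<bar> \<le> r"
  shows "T v \<le> B * r"
proof -
  have "v = (v $ 1) *\<^sub>R axis 1 1 + (v $ 2) *\<^sub>R axis 2 1"
    by (simp add: vec_eq_iff forall_2 axis_def)
  then have "T v \<le> T ((v $ 1) *\<^sub>R axis 1 1) + T ((v $ 2) *\<^sub>R axis 2 1)"
    using T_add by metis
  also have "\<dots> = \<bar>v $ 1\<bar> * T (axis 1 1) + \<bar>v $ 2\<bar> * T (axis 2 1)" by (simp add: T_scale)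
  also have "\<dots> \<le> r * T (axis 1 1) + r * T (axis 2 1)"
    using assms by (intro add_mono mult_right_mono) auto
  finally show ?thesis by (simp add: B_def algebra_simps)
qed

lemma T_le_cube:
  assumes "v \<in> cbox 0 1" "w \<in> cbox 0 1"
  shows "T (v - w) \<le> B"
proof -
  have "\<bar>(v - w) $ k\<bar> \<le> 1" for k
  proof -
    have "0 \<le> v $ k" "v $ k \<le> 1" "0 \<le> w $ k" "w $ k \<le> 1"
      using assms by (auto simp: mem_box_cart)
    then show ?thesis by auto
  qed
  then show ?thesis using T_le[of "v - w" 1] by simp
qed

text \<open>The list \<open>es\<close> holds at most the end node of the ring. For
  \<open>es = []\<close> the truck stops at its last node and the drone at its drone node. Without a
  drone the second argument of the maximum is 0, which is harmless because truck lengths are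
  nonnegative.\<close>

definition leg :: "('i \<Rightarrow> real^2) \<Rightarrow> 'i \<times> 'i list \<times> 'i option \<Rightarrow> 'i list \<Rightarrow> real" where
  "leg x s es = (case s of (a, ts, d) \<Rightarrow>
     max (path_length T (map x (a # ts @ es)))
         (case d of None \<Rightarrow> 0 | Some p \<Rightarrow> path_length D (map x (a # p # es))))"

primrec plan_cost :: "('i \<Rightarrow> real^2) \<Rightarrow> 'i list \<Rightarrow> 'i plan \<Rightarrow> real" where
  "plan_cost x es [] = 0"
| "plan_cost x es (s # g) = leg x s (next_start g es) + plan_cost x es g"

lemma plan_cost_append:
  "plan_cost x es (g @ g') = plan_cost x (next_start g' es) g + plan_cost x es g'"
  by (induction g) (auto simp: next_start_append)

lemma leg_nonneg [simp]: "0 \<le> leg x s es"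
  unfolding leg_def by (cases s) (simp add: le_max_iff_disj)

lemma plan_cost_nonneg [simp]: "0 \<le> plan_cost x es g"
  by (induction g) auto

lemma T_path_le_leg: "path_length T (map x (a # ts @ es)) \<le> leg x (a, ts, d) es"
  by (simp add: leg_def)

text \<open>Closing the leg at \<open>b\<close> adds one edge to each of the two paths, so their
  maximum grows by at most \<delta>. The last drone edge is controlled through
  \<open>D_le_T\<close>.\<close>

lemma leg_extend:
  assumes "\<And>i. i \<in> set (seg_nodes s) \<Longrightarrow> T (x b - x i) \<le> \<delta>"
  shows "leg x s [b] \<le> leg x s [] + \<delta>"
proof -
  obtain a ts d where s: "s = (a, ts, d)" by (cases s)
  have "T (x b - last (map x (a # ts))) \<le> \<delta>"
    using assms unfolding s by (auto simp: seg_nodes_def last_map)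
  then have t: "path_length T (map x (a # ts @ [b])) \<le> path_length T (map x (a # ts)) + \<delta>"
    using path_length_append_eq[of "map x (a # ts)" T "x b" "[]"] by simp
  have "T (x b - x a) \<le> \<delta>" using assms unfolding s by (auto simp: seg_nodes_def)
  then have \<delta>: "0 \<le> \<delta>" using T_nonneg order_trans by blast
  show ?thesis
  proof (cases d)
    case None
    then show ?thesis using t \<delta> unfolding s leg_def by auto
  next
    case (Some p)
    then have "D (x b - x p) \<le> \<delta>"
      using assms D_le_T[of "x b - x p"] unfolding s by (auto simp: seg_nodes_def intro: order_trans)
    then show ?thesis using t \<delta> Some unfolding s leg_def by auto
  qed
qed

lemma leg_open_le: "leg x s [] \<le> leg x s es"
proof -
  obtain a ts d where s: "s = (a, ts, d)" by (cases s)
  have t: "path_length T (map x (a # ts)) \<le> path_length T (map x (a # ts @ es))"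
  proof (cases es)
    case (Cons b bs)
    then show ?thesis
      using path_length_append_eq[of "map x (a # ts)" T "x b" "map x bs"] by simp
  qed simp
  have d: "path_length D (map x [a, p]) \<le> path_length D (map x (a # p # es))" for p
    using path_length_D_nonneg[of "x p # map x es"] by simp
  show ?thesis
    using t d unfolding s leg_def prod.case
    by (intro max.mono) (auto split: option.splits simp del: path_length.simps)
qed

lemma plan_cost_open_le: "plan_cost x [] g \<le> plan_cost x es g"
proof (induction g)
  case (Cons s g)
  then show ?case using leg_open_le[of x s es] by (cases g) auto
qed simp

text \<open>Only the last leg depends on \<open>es\<close>, so \<delta> is paid once.\<close>

lemma plan_cost_extend:
  assumes "\<And>i. i \<in> set (plan_nodes g) \<Longrightarrow> T (x b - x i) \<le> \<delta>" "0 \<le> \<delta>"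
  shows "plan_cost x [b] g \<le> plan_cost x [] g + \<delta>"
  using assms
proof (induction g)
  case (Cons s g)
  then show ?case using leg_extend[of s x b \<delta>] by (cases g) auto
qed simp

text \<open>The last leg of \<open>g\<close>, open before, now ends at the first combined node
  \<open>b\<close> of \<open>g'\<close>; all other legs keep their ends.\<close>

lemma plan_cost_concat:
  assumes "\<And>i. i \<in> set (plan_nodes g) \<Longrightarrow> T (x b - x i) \<le> \<delta>" "0 \<le> \<delta>" "next_start g' [] = [b]"
  shows "plan_cost x [] (g @ g') \<le> plan_cost x [] g + plan_cost x [] g' + \<delta>"
  using plan_cost_extend[of g x b \<delta>] assms by (simp add: plan_cost_append)

text \<open>These are the local surgeries for the removal of a node: shortcutting a truck node,
  giving up a drone node, letting the first truck node take over as start, and merging two legs at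
  their common node \<open>f\<close>. In the last two the drone path would change in an uncontrolled
  way, so the drone is given up; a leg without a drone costs just its truck path, and that is
  bounded by shortcuts of the old truck paths.\<close>

lemma leg_delete:
  shows "leg x (a, u @ v, d) es \<le> leg x (a, u @ f # v, d) es"
    and "leg x (a, ts, None) es \<le> leg x (a, ts, d) es"
    and "leg x (s, ts, None) es \<le> leg x (a, s # ts, d) es"
    and "leg x (a, ts @ us, None) es \<le> leg x (a, ts, d) [f] + leg x (f, us, d') es"
proof -
  show "leg x (a, u @ v, d) es \<le> leg x (a, u @ f # v, d) es"
    using path_length_T_delete[of "map x (a # u)" "map x (v @ es)" "x f"]
    by (auto simp: leg_def split: option.splits)
  show "leg x (a, ts, None) es \<le> leg x (a, ts, d) es"
    by (auto simp: leg_def split: option.splits)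
  show "leg x (s, ts, None) es \<le> leg x (a, s # ts, d) es"
    using T_path_le_leg[of x a "s # ts" es d] T_nonneg[of "x s - x a"]
    by (simp add: leg_def del: T_nonneg)
  have "path_length T (map x (a # ts @ us @ es)) \<le> path_length T (map x (a # ts @ f # us @ es))"
    using path_length_T_delete[of "map x (a # ts)" "map x (us @ es)" "x f"] by simp
  also have "\<dots> = path_length T (map x (a # ts @ [f])) + path_length T (map x (f # us @ es))"
    using path_length_append[of T "map x (a # ts)" "x f" "map x (us @ es)"] by simp
  also have "\<dots> \<le> leg x (a, ts, d) [f] + leg x (f, us, d') es"
    by (intro add_mono T_path_le_leg)
  finally show "leg x (a, ts @ us, None) es \<le> leg x (a, ts, d) [f] + leg x (f, us, d') es"
    by (simp add: leg_def)
qed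

text \<open>Removing a combined node merges its two rings into one. Their drone nodes are dropped as
  well, since the merged ring could serve only one of them.\<close>

lemma plan_delete:
  assumes "distinct (plan_nodes g)"
  shows "\<exists>g'. distinct (plan_nodes g') \<and> set (plan_nodes g') \<subseteq> set (plan_nodes g) - {f} \<and>
    card (set (plan_nodes g) - set (plan_nodes g')) \<le> 3 \<and> plan_cost x [] g' \<le> plan_cost x [] g"
proof (cases "f \<in> set (plan_nodes g)")
  case False
  then show ?thesis using assms by (intro exI[of _ g]) auto
next
  case True
  then obtain s where "s \<in> set g" and fs: "f \<in> set (seg_nodes s)" by (auto simp: plan_nodes_def)
  then obtain g1 g2 a ts d where g: "g = g1 @ (a, ts, d) # g2" and s: "s = (a, ts, d)"
    by (metis split_list prod_cases3)
  \<comment> \<open>The 3 counts \<open>f\<close> itself and the at most two drone nodes of the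
    rings that meet at a combined node \<open>f\<close>.\<close>
  have card3: "card (set (plan_nodes g) - A) \<le> 3"
    if "set (plan_nodes g) - A \<subseteq> insert f (set_option p \<union> set_option q)" for A p q
  proof -
    have fin: "finite (insert f (set_option p \<union> set_option q))" by auto
    have "card (set_option r) \<le> 1" for r :: "'b option" by (cases r) auto
    then have "card (set_option p \<union> set_option q) \<le> 2"
      using card_Un_le[of "set_option p" "set_option q"] by (metis add_le_mono one_add_one order_trans)
    then have "card (insert f (set_option p \<union> set_option q)) \<le> 3"
      using card_insert_le_m1 by (simp add: card_insert_if)
    then show ?thesis using card_mono[OF fin that] by linarith
  qed
  have set_d: "set (case d of None \<Rightarrow> [] | Some p \<Rightarrow> [p]) = set_option d" for d :: "'b option"
    by (cases d) auto
  have dist: "distinct (case d of None \<Rightarrow> [] | Some p \<Rightarrow> [p])" for d :: "'b option"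
    by (cases d) auto
  consider (truck) "f \<in> set ts" | (drone) "d = Some f"
    | (comb) "f = a"
    using fs s by (auto simp: seg_nodes_def split: option.splits)
  then show ?thesis
  proof cases
    case truck
    then obtain u v where ts: "ts = u @ f # v" by (meson split_list)
    let ?g = "g1 @ (a, u @ v, d) # g2"
    have "distinct (plan_nodes ?g)" "set (plan_nodes ?g) \<subseteq> set (plan_nodes g) - {f}"
      using assms unfolding g ts by (auto simp: seg_nodes_def set_d dist)
    moreover have "card (set (plan_nodes g) - set (plan_nodes ?g)) \<le> 3"
      by (rule card3[of _ None None]) (auto simp: g ts seg_nodes_def)
    moreover have "plan_cost x [] ?g \<le> plan_cost x [] g"
      using leg_delete(1) unfolding g ts by (auto simp: plan_cost_append)
    ultimately show ?thesis by blast
  next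
    case drone
    let ?g = "g1 @ (a, ts, None) # g2"
    have "distinct (plan_nodes ?g)" "set (plan_nodes ?g) \<subseteq> set (plan_nodes g) - {f}"
      using assms unfolding g drone by auto
    moreover have "card (set (plan_nodes g) - set (plan_nodes ?g)) \<le> 3"
      by (rule card3[of _ None None]) (auto simp: g drone)
    moreover have "plan_cost x [] ?g \<le> plan_cost x [] g"
      using leg_delete(2) unfolding g by (auto simp: plan_cost_append)
    ultimately show ?thesis by blast
  next
    case comb
    show ?thesis
    \<comment> \<open>If \<open>f\<close> starts the very first ring, there is no preceding ring to
      merge with. The ring then disappears if it has no truck nodes; otherwise its first truck node
      becomes the new start. In the remaining case the ring is absorbed by its predecessor.\<close>
    proof (cases g1 rule: rev_cases)
      case Nil
      show ?thesis
      proof (cases ts)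
        case Nil': Nil
        have "distinct (plan_nodes g2)" "set (plan_nodes g2) \<subseteq> set (plan_nodes g) - {f}"
          using assms unfolding g Nil Nil' comb by (auto simp: seg_nodes_def)
        moreover have "card (set (plan_nodes g) - set (plan_nodes g2)) \<le> 3"
          by (rule card3[of _ d None]) (auto simp: g Nil Nil' comb seg_nodes_def set_d)
        moreover have "plan_cost x [] g2 \<le> plan_cost x [] g"
          unfolding g Nil by simp
        ultimately show ?thesis by blast
      next
        case (Cons b us)
        let ?g = "(b, us, None) # g2"
        have "distinct (plan_nodes ?g)" "set (plan_nodes ?g) \<subseteq> set (plan_nodes g) - {f}"
          using assms unfolding g Nil Cons comb by (auto simp: seg_nodes_def)
        moreover have "card (set (plan_nodes g) - set (plan_nodes ?g)) \<le> 3"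
          by (rule card3[of _ d None]) (auto simp: g Nil Cons comb seg_nodes_def set_d)
        moreover have "plan_cost x [] ?g \<le> plan_cost x [] g"
          using leg_delete(3) unfolding g Nil Cons by auto
        ultimately show ?thesis by blast
      qed
    next
      case (snoc g0 s0)
      obtain b us d0 where s0: "s0 = (b, us, d0)" by (cases s0)
      let ?g = "g0 @ (b, us @ ts, None) # g2"
      have "distinct (plan_nodes ?g)" "set (plan_nodes ?g) \<subseteq> set (plan_nodes g) - {f}"
        using assms unfolding g snoc s0 comb by (auto simp: seg_nodes_def)
      moreover have "card (set (plan_nodes g) - set (plan_nodes ?g)) \<le> 3"
        by (rule card3[of _ d0 d]) (auto simp: g snoc s0 comb seg_nodes_def set_d)
      moreover have "plan_cost x [] ?g \<le> plan_cost x [] g"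
        using leg_delete(4) unfolding g snoc s0 comb by (auto simp: plan_cost_append)
      ultimately show ?thesis by blast
    qed
  qed
qed

text \<open>The nodes of \<open>F\<close> are deleted one at a time. A node may already have been
  dropped together with an earlier one, which is why \<open>plan_delete\<close> does not assume that
  \<open>f\<close> occurs in the plan.\<close>

lemma plan_delete_set:
  assumes "finite F" "distinct (plan_nodes g)"
  shows "\<exists>g'. distinct (plan_nodes g') \<and> set (plan_nodes g') \<subseteq> set (plan_nodes g) - F \<and>
    card (set (plan_nodes g) - set (plan_nodes g')) \<le> 3 * card F \<and>
    plan_cost x [] g' \<le> plan_cost x [] g"
  using assms(1)
proof induction
  case empty
  then show ?case using assms(2) by (intro exI[of _ g]) auto
next
  case (insert f F)
  then obtain h where h: "distinct (plan_nodes h)" "set (plan_nodes h) \<subseteq> set (plan_nodes g) - F"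
    "card (set (plan_nodes g) - set (plan_nodes h)) \<le> 3 * card F"
    "plan_cost x [] h \<le> plan_cost x [] g" by blast
  obtain k where k: "distinct (plan_nodes k)" "set (plan_nodes k) \<subseteq> set (plan_nodes h) - {f}"
    "card (set (plan_nodes h) - set (plan_nodes k)) \<le> 3"
    "plan_cost x [] k \<le> plan_cost x [] h" using plan_delete[OF h(1)] by blast
  have "card (set (plan_nodes g) - set (plan_nodes k)) \<le>
    card ((set (plan_nodes g) - set (plan_nodes h)) \<union> (set (plan_nodes h) - set (plan_nodes k)))"
    by (rule card_mono) auto
  also have "\<dots> \<le> 3 * card F + 3" using h(3) k(3) card_Un_le by (meson add_mono order_trans)
  finally show ?case using h k insert by (intro exI[of _ k]) auto
qed

section \<open>Optimal open plans: merging, scaling and relabeling\<close>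

definition opt :: "('i \<Rightarrow> real^2) \<Rightarrow> 'i set \<Rightarrow> real" where
  "opt x I = Min (plan_cost x [] ` plans I)"

lemma opt_le: "finite I \<Longrightarrow> g \<in> plans I \<Longrightarrow> opt x I \<le> plan_cost x [] g"
  unfolding opt_def by (intro Min_le finite_imageI finite_plans imageI)

lemma opt_attained:
  assumes "finite I"
  obtains g where "g \<in> plans I" "opt x I = plan_cost x [] g"
proof -
  have "opt x I \<in> plan_cost x [] ` plans I"
    unfolding opt_def using assms by (intro Min_in) (auto simp: finite_plans plans_nonempty)
  then show ?thesis using that by blast
qed

lemma opt_nonneg: "finite I \<Longrightarrow> 0 \<le> opt x I"
  by (rule opt_attained[of I x]) auto

lemma opt_empty [simp]: "opt x {} = 0"
  using opt_le[of "{}" "[]" x] opt_nonneg[of "{}" x] by (simp add: plans_def)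

lemma opt_merge:
  assumes "finite I" "finite J" "I \<inter> J = {}" "0 \<le> \<delta>"
    "\<And>i j. i \<in> I \<Longrightarrow> j \<in> J \<Longrightarrow> T (x j - x i) \<le> \<delta>"
  shows "opt x (I \<union> J) \<le> opt x I + opt x J + \<delta>"
proof -
  obtain g h where g: "g \<in> plans I" "opt x I = plan_cost x [] g"
    and h: "h \<in> plans J" "opt x J = plan_cost x [] h"
    using opt_attained assms(1,2) by metis
  have "g @ h \<in> plans (I \<union> J)" using g h assms(3) by (auto simp: plans_def)
  then have le: "opt x (I \<union> J) \<le> plan_cost x [] (g @ h)" using assms by (intro opt_le) auto
  show ?thesis
  proof (cases h)
    case Nil
    then show ?thesis using le g h assms(4) by simp
  next
    case (Cons s h')
    then have "fst s \<in> J" using h fst_in_seg_nodes[of s] by (auto simp: plans_def)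
    then have "plan_cost x [] (g @ h) \<le> plan_cost x [] g + plan_cost x [] h + \<delta>"
      using assms(4,5) g(1) by (intro plan_cost_concat[of _ _ "fst s"]) (auto simp: plans_def Cons)
    then show ?thesis using le g h by simp
  qed
qed

lemma path_length_scale:
  assumes "\<And>v. N (c *\<^sub>R v) = c * N v"
  shows "path_length N (map (\<lambda>i. c *\<^sub>R x i + b) is) = c * path_length N (map x is)"
proof (induction "is" rule: induct_list012)
  case (3 i j "is")
  have "c *\<^sub>R x j + b - (c *\<^sub>R x i + b) = c *\<^sub>R (x j - x i)"
    by (simp add: scaleR_diff_right)
  then have "N (c *\<^sub>R x j + b - (c *\<^sub>R x i + b)) = c * N (x j - x i)"
    by (simp only: assms)
  then show ?case using 3 by (simp add: distrib_left)
qed auto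

lemma plan_cost_cong:
  assumes "\<And>i. i \<in> set (plan_nodes g) \<union> set es \<Longrightarrow> x i = y i"
  shows "plan_cost x es g = plan_cost y es g"
  using assms
proof (induction g)
  case (Cons s g)
  have "leg x s (next_start g es) = leg y s (next_start g es)"
  proof -
    have n: "x i = y i" if "i \<in> set (next_start g es)" for i
    proof (cases g)
      case (Cons r g')
      then have "i \<in> set (plan_nodes g)" using that fst_in_seg_nodes[of r] by auto
      then show ?thesis using Cons.prems by auto
    qed (use that Cons.prems in auto)
    obtain a ts d where s: "s = (a, ts, d)" by (cases s)
    have e: "x i = y i" if "i \<in> set (seg_nodes s)" for i using that Cons.prems by auto
    have 1: "map x (a # ts @ next_start g es) = map y (a # ts @ next_start g es)"
      using n e unfolding s by (intro map_cong) (auto simp: seg_nodes_def)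
    have 2: "map x (a # p # next_start g es) = map y (a # p # next_start g es)" if "d = Some p" for p
      using n e that unfolding s by (intro map_cong) (auto simp: seg_nodes_def)
    show ?thesis
    proof (cases d)
      case None
      then show ?thesis by (simp only: leg_def s prod.case 1 option.case)
    next
      case (Some p)
      then show ?thesis by (simp only: leg_def s prod.case 1 2[OF Some] option.case)
    qed
  qed
  then show ?case using Cons by auto
qed simp

lemma opt_cong:
  assumes "\<And>i. i \<in> I \<Longrightarrow> x i = y i"
  shows "opt x I = opt y I"
  unfolding opt_def
  by (intro arg_cong[where f = Min] image_cong refl plan_cost_cong) (auto simp: plans_def assms)

lemma plan_cost_scale:
  assumes "0 \<le> c"
  shows "plan_cost (\<lambda>i. c *\<^sub>R x i + b) es g = c * plan_cost x es g"
proof -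
  have "leg (\<lambda>i. c *\<^sub>R x i + b) s es = c * leg x s es" for s es
  proof -
    have "path_length T (map (\<lambda>i. c *\<^sub>R x i + b) is) = c * path_length T (map x is)"
      "path_length D (map (\<lambda>i. c *\<^sub>R x i + b) is) = c * path_length D (map x is)" for "is"
      using assms by (auto intro!: path_length_scale simp: T_scale D_scale)
    then show ?thesis
      unfolding leg_def using assms
      by (auto simp del: path_length.simps list.map split: prod.splits option.splits simp: max_mult_distrib_left)
  qed
  then show ?thesis by (induction g) (auto simp: algebra_simps)
qed

lemma opt_scale:
  assumes "0 \<le> c" "finite I"
  shows "opt (\<lambda>i. c *\<^sub>R x i + b) I = c * opt x I"
proof -
  have "mono ((*) c)" using assms by (simp add: mono_def mult_left_mono)
  then have "c * Min (plan_cost x [] ` plans I) = Min ((*) c ` plan_cost x [] ` plans I)"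
    using assms by (intro mono_Min_commute) (auto simp: finite_plans plans_nonempty)
  then show ?thesis unfolding opt_def by (simp add: image_image plan_cost_scale[OF assms(1)])
qed

definition map_plan :: "('i \<Rightarrow> 'j) \<Rightarrow> 'i plan \<Rightarrow> 'j plan" where
  "map_plan f = map (map_prod f (map_prod (map f) (map_option f)))"

lemma plan_nodes_map_plan: "plan_nodes (map_plan f g) = map f (plan_nodes g)"
  by (induction g) (auto simp: map_plan_def seg_nodes_def split: option.splits)

lemma plan_cost_map_plan: "plan_cost x (map f es) (map_plan f g) = plan_cost (x \<circ> f) es g"
proof (induction g)
  case (Cons s g)
  have "next_start (map_plan f g) (map f es) = map f (next_start g es)"
    by (cases g) (auto simp: map_plan_def)
  moreover have "leg x (map_prod f (map_prod (map f) (map_option f)) s) (map f es) = leg (x \<circ> f) s es"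
    for es
    by (auto simp: leg_def split: prod.splits option.splits)
  ultimately show ?case using Cons by (simp add: map_plan_def del: o_apply)
qed (simp add: map_plan_def)

lemma opt_image_le:
  assumes "finite I" "inj_on f I"
  shows "opt x (f ` I) \<le> opt (x \<circ> f) I"
proof -
  obtain g where g: "g \<in> plans I" "opt (x \<circ> f) I = plan_cost (x \<circ> f) [] g"
    using opt_attained assms(1) by metis
  have "map_plan f g \<in> plans (f ` I)"
    using g(1) assms(2) by (auto simp: plans_def plan_nodes_map_plan distinct_map)
  then show ?thesis
    using opt_le[of "f ` I" "map_plan f g" x] plan_cost_map_plan[of x f "[]" g] assms g(2) by simp
qed

text \<open>The reverse inequality is \<open>opt_image_le\<close> for the inverse relabeling. This
  is the bridge between functionals of indices and functionals of points, and it also makes the law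
  of the cost depend only on the number of indices.\<close>

lemma opt_image:
  assumes "finite I" "inj_on f I"
  shows "opt x (f ` I) = opt (x \<circ> f) I"
proof (rule antisym[OF opt_image_le[OF assms]])
  let ?h = "inv_into I f"
  have "opt (x \<circ> f) (?h ` f ` I) \<le> opt ((x \<circ> f) \<circ> ?h) (f ` I)"
    using assms by (intro opt_image_le inj_on_inv_into) auto
  also have "\<dots> = opt x (f ` I)"
    by (rule opt_cong) (auto simp: assms f_inv_into_f)
  finally show "opt (x \<circ> f) I \<le> opt x (f ` I)" using assms by simp
qed

end

section \<open>Comparison with optimal makespans and growth bounds\<close>

text \<open>The minimum puts the right end point \<open>t = 1\<close> into the last of the
  \<open>m\<close> cells.\<close>

definition cell :: "nat \<Rightarrow> real \<Rightarrow> nat" where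
  "cell m t = min (nat \<lfloor>real m * t\<rfloor>) (m - 1)"

lemma cell_bounds:
  assumes "1 \<le> m" "0 \<le> t" "t \<le> 1"
  shows "cell m t < m" "real (cell m t) / real m \<le> t" "t \<le> (real (cell m t) + 1) / real m"
proof -
  show "cell m t < m" using assms(1) by (simp add: cell_def min_less_iff_disj)
  have "real (cell m t) \<le> real m * t \<and> real m * t \<le> real (cell m t) + 1"
  proof (cases "nat \<lfloor>real m * t\<rfloor> \<le> m - 1")
    case True
    then have c: "real (cell m t) = of_int \<lfloor>real m * t\<rfloor>"
      using assms by (simp add: cell_def min_def)
    show ?thesis unfolding c by linarith
  next
    case False
    then have c: "cell m t = m - 1" by (simp add: cell_def min_def)
    have "real (m - 1) \<le> real m * t"
      using False by linarith
    moreover have "real m * t \<le> real m" using assms by (simp add: mult_left_le)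
    ultimately show ?thesis using assms(1) unfolding c by (simp add: of_nat_diff)
  qed
  then show "real (cell m t) / real m \<le> t" "t \<le> (real (cell m t) + 1) / real m"
    using assms(1) by (simp_all add: field_simps)
qed

section \<open>Closing a plan into a cyclic tour of rings\<close>

lemma seg_nodes_disjoint:
  assumes "distinct (plan_nodes g)" "s \<in> set g" "s' \<in> set g" "s \<noteq> s'"
  shows "set (seg_nodes s) \<inter> set (seg_nodes s') = {}"
  using assms
proof (induction g)
  case (Cons r g)
  have sub: "set (seg_nodes q) \<subseteq> set (plan_nodes g)" if "q \<in> set g" for q
    using that by (auto simp: plan_nodes_def)
  have d: "set (seg_nodes r) \<inter> set (plan_nodes g) = {}" "distinct (plan_nodes g)"
    using Cons.prems by auto
  consider "s = r" "s' \<in> set g" | "s' = r" "s \<in> set g" | "s \<in> set g" "s' \<in> set g"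
    using Cons.prems by auto
  then show ?case by cases (use sub d Cons in blast)+
qed simp

lemma distinct_starts:
  assumes "distinct (plan_nodes g)"
  shows "distinct (map fst g)"
  using assms
proof (induction g)
  case (Cons s g)
  have "fst ` set g \<subseteq> set (plan_nodes g)"
    using fst_in_seg_nodes by (fastforce simp: plan_nodes_def)
  then show ?case using Cons fst_in_seg_nodes[of s] by auto
qed simp

text \<open>The argument \<open>e\<close> is the end node of the last ring; the tour is closed by
  taking the start of the first ring for it. The order of the truck nodes is forgotten, since
  \<open>ring_cost\<close> minimizes over it.\<close>

fun plan_rings :: "(real^2) plan \<Rightarrow> real^2 \<Rightarrow> drone_ring list" where
  "plan_rings [] e = []"
| "plan_rings ((a, ts, d) # g) e =
     Ring a (case g of [] \<Rightarrow> e | s # _ \<Rightarrow> fst s) (set ts) d # plan_rings g e"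

lemma map_start_plan_rings: "map start_node (plan_rings g e) = map fst g"
  by (induction g e rule: plan_rings.induct) auto

lemma map_end_plan_rings: "g \<noteq> [] \<Longrightarrow> map end_node (plan_rings g e) = tl (map fst g) @ [e]"
proof (induction g e rule: plan_rings.induct)
  case (2 a ts d g e)
  then show ?case by (cases g) auto
qed simp

lemma plan_rings_seg:
  assumes "r \<in> set (plan_rings g e)"
  shows "\<exists>s. s \<in> set g \<and> start_node r = fst s \<and> truck_nodes r = set (fst (snd s)) \<and>
    drone_node r = snd (snd s) \<and> set (seg_nodes s) = insert (start_node r) (inner_nodes r)"
proof -
  have "\<exists>s \<in> set g. start_node r = fst s \<and> truck_nodes r = set (fst (snd s)) \<and>
    drone_node r = snd (snd s)"
    using assms by (induction g e rule: plan_rings.induct) auto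
  then obtain s where s: "s \<in> set g" "start_node r = fst s" "truck_nodes r = set (fst (snd s))"
    "drone_node r = snd (snd s)" by blast
  moreover have "set (seg_nodes s) = insert (start_node r) (inner_nodes r)"
  proof -
    obtain a ts d where "s = (a, ts, d)" by (cases s)
    then show ?thesis using s(2-4) by (cases d) (simp_all add: inner_nodes_def)
  qed
  ultimately show ?thesis by blast
qed

lemma set_plan_nodes_rings:
  "set (plan_nodes g) = start_node ` set (plan_rings g e) \<union> (\<Union>r\<in>set (plan_rings g e). inner_nodes r)"
  by (induction g e rule: plan_rings.induct)
     (auto simp: inner_nodes_def seg_nodes_def split: option.splits)

text \<open>Two entries are required because a ring must end at a node other than its start: the
  successor index \<open>Suc i mod length g\<close> differs from \<open>i\<close> only if there are
  at least two rings, and the starts are distinct.\<close>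

lemma feasible_plan_rings:
  assumes g: "g \<in> plans X" and len: "2 \<le> length g"
  shows "feasible_solution X (set (plan_rings g (fst (hd g))))"
proof -
  define e where "e = fst (hd g)"
  define R where "R = set (plan_rings g e)"
  have dist: "distinct (plan_nodes g)" and X: "set (plan_nodes g) = X" using g by (auto simp: plans_def)
  have starts: "map start_node (plan_rings g e) = map fst g" by (rule map_start_plan_rings)
  have d: "distinct (map start_node (plan_rings g e))"
    unfolding starts by (rule distinct_starts[OF dist])
  have inj: "inj_on start_node R" using d unfolding R_def by (simp add: distinct_map)
  have ends: "map end_node (plan_rings g e) = rotate1 (map start_node (plan_rings g e))"
    using len unfolding starts by (cases g) (auto simp: map_end_plan_rings e_def)
  have ne: "plan_rings g e \<noteq> []" using starts len by force
  have cyc: "cyclic_tour R" unfolding cyclic_tour_def R_def using d ends ne by blast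
  have starts_R: "start_node ` R = fst ` set g" using starts unfolding R_def by (metis list.set_map)
  have ends_R: "end_node ` R = start_node ` R" by (rule cyclic_tour_end_nodes[OF cyc])
  have inn: "inner_nodes r \<inter> start_node ` R = {}" "start_node r \<noteq> end_node r"
    "truck_nodes r \<inter> set_option (drone_node r) = {}" if r: "r \<in> R" for r
  proof -
    obtain s where s: "s \<in> set g" "start_node r = fst s" "truck_nodes r = set (fst (snd s))"
      "drone_node r = snd (snd s)" "set (seg_nodes s) = insert (start_node r) (inner_nodes r)"
      using plan_rings_seg[OF r[unfolded R_def]] by blast
    have "distinct (seg_nodes s)"
      using dist s(1) by (induction g) auto
    then have ds: "start_node r \<notin> inner_nodes r" "truck_nodes r \<inter> set_option (drone_node r) = {}"
      using s by (cases s; force simp: seg_nodes_def inner_nodes_def split: option.splits)+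
    then show "truck_nodes r \<inter> set_option (drone_node r) = {}" by simp
    have "fst s' \<notin> inner_nodes r" if "s' \<in> set g" for s'
    proof (cases "s' = s")
      case False
      then show ?thesis using seg_nodes_disjoint[OF dist that s(1)] s(5) fst_in_seg_nodes[of s'] by auto
    qed (use ds s in simp)
    then show "inner_nodes r \<inter> start_node ` R = {}" unfolding starts_R by auto
    obtain i where i: "i < length g" "r = plan_rings g e ! i"
      using r starts unfolding R_def by (metis in_set_conv_nth length_map)
    have l: "length (plan_rings g e) = length g" using starts by (metis length_map)
    have 1: "start_node r = map start_node (plan_rings g e) ! i" using i l by simp
    have "end_node r = rotate1 (map start_node (plan_rings g e)) ! i"
      using i l ends by (metis nth_map)
    also have "\<dots> = map start_node (plan_rings g e) ! (Suc i mod length g)"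
      using i l by (simp add: nth_rotate1)
    finally have 2: "end_node r = map start_node (plan_rings g e) ! (Suc i mod length g)" .
    have "Suc i mod length g \<noteq> i" using i len by (cases "Suc i = length g") auto
    moreover have "Suc i mod length g < length g" using i by (intro mod_less_divisor) auto
    ultimately show "start_node r \<noteq> end_node r"
      unfolding 1 2 using nth_eq_iff_index_eq[OF d, of i "Suc i mod length g", unfolded length_map l] i(1)
      by metis
  qed
  have "is_ring r" if r: "r \<in> R" for r
  proof -
    have fin: "finite (truck_nodes r)" using plan_rings_seg[OF r[unfolded R_def]] by auto
    have "end_node r \<in> start_node ` R" using ends_R r by blast
    then have "{start_node r, end_node r} \<inter> inner_nodes r = {}" using inn(1)[OF r] r by blast
    then show ?thesis using inn(2,3)[OF r] fin by (simp add: is_ring_def)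
  qed
  moreover have "disjoint_family_on inner_nodes R"
    unfolding disjoint_family_on_def
  proof (intro ballI impI)
    fix r r' assume r: "r \<in> R" "r' \<in> R" "r \<noteq> r'"
    obtain s where s: "s \<in> set g" "start_node r = fst s" "set (seg_nodes s) = insert (start_node r) (inner_nodes r)"
      using plan_rings_seg[OF r(1)[unfolded R_def]] by blast
    obtain s' where s': "s' \<in> set g" "start_node r' = fst s'" "set (seg_nodes s') = insert (start_node r') (inner_nodes r')"
      using plan_rings_seg[OF r(2)[unfolded R_def]] by blast
    have "start_node r \<noteq> start_node r'" using inj r by (meson inj_onD)
    then have "s \<noteq> s'" using s(2) s'(2) by auto
    then show "inner_nodes r \<inter> inner_nodes r' = {}"
      using seg_nodes_disjoint[OF dist s(1) s'(1)] s s' by auto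
  qed
  moreover have "X = start_node ` R \<union> (\<Union>r\<in>R. inner_nodes r)"
    using set_plan_nodes_rings[of g e] X unfolding R_def by simp
  ultimately have "feasible_solution X R" unfolding feasible_solution_def using cyc inn(1) by simp
  then show ?thesis by (simp add: R_def e_def)
qed

section \<open>Square-root growth and smoothness of the optimal cost\<close>

context truck_drone
begin

text \<open>Pigeonhole principle on an \<open>m\<close> by \<open>m\<close> grid with
  \<open>m * m < card I\<close>: two points in a common cell differ by at most \<open>1 / m\<close>
  in each coordinate.\<close>

lemma close_pair:
  assumes "2 \<le> card I" "\<And>i. i \<in> I \<Longrightarrow> x i \<in> cbox 0 1"
  obtains i j where "i \<in> I" "j \<in> I" "i \<noteq> j" "T (x i - x j) \<le> 4 * B / sqrt (card I)"
proof -
  define n where "n = card I"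
  define m where "m = nat \<lceil>sqrt n\<rceil> - 1"
  have "sqrt 2 \<le> sqrt n" using assms(1) by (simp add: n_def)
  \<comment> \<open>The threshold 4/3 is where \<open>s - 1\<close> reaches \<open>s / 4\<close>;
    with \<open>s = sqrt n\<close> this turns \<open>m \<ge> s - 1\<close> into
    \<open>s \<le> 4 * m\<close>.\<close>
  moreover have "4 / 3 \<le> sqrt 2" by (rule real_le_rsqrt) (simp add: power2_eq_square)
  ultimately have r: "4 / 3 \<le> sqrt n" by linarith
  then have m: "real m = of_int \<lceil>sqrt n\<rceil> - 1" unfolding m_def by linarith
  then have "real m < sqrt n" "sqrt n \<le> 4 * real m" using r by linarith+
  moreover have "0 < real m" using r m by linarith
  ultimately have m: "1 \<le> m" "real m < sqrt n" "sqrt n \<le> 4 * real m" by linarith+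
  have "(real m)\<^sup>2 < n" using m by (metis of_nat_0_le_iff power_strict_mono real_sqrt_pow2 zero_less_numeral)
  then have "m * m < n" by (metis of_nat_less_iff of_nat_power power2_eq_square)
  moreover define f where "f i = (cell m (x i $ 1), cell m (x i $ 2))" for i
  have bd: "0 \<le> x i $ k" "x i $ k \<le> 1" if "i \<in> I" for i k
    using assms(2)[OF that] by (auto simp: mem_box_cart)
  have "f ` I \<subseteq> {..<m} \<times> {..<m}"
    using bd cell_bounds(1)[OF m(1)] by (auto simp: f_def)
  then have "card (f ` I) \<le> m * m" using card_mono[of "{..<m} \<times> {..<m}"] by simp
  ultimately have "card (f ` I) < card I" by (simp add: n_def)
  then have "\<not> inj_on f I" by (rule pigeonhole)
  then obtain i j where ij: "i \<in> I" "j \<in> I" "i \<noteq> j" "f i = f j" by (auto simp: inj_on_def)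
  have "\<bar>(x i - x j) $ k\<bar> \<le> 1 / m" for k
  proof -
    have "cell m (x i $ k) = cell m (x j $ k)"
      using ij(4) exhaust_2[of k] by (auto simp: f_def)
    then show ?thesis
      using cell_bounds(2,3)[OF m(1) bd[OF ij(1)], of k] cell_bounds(2,3)[OF m(1) bd[OF ij(2)], of k]
      by (auto simp: add_divide_distrib)
  qed
  then have "T (x i - x j) \<le> B * (1 / m)" by (rule T_le)
  also have "B * (1 / m) \<le> B * (4 / sqrt n)"
  proof (rule mult_left_mono)
    have "0 < sqrt n" using r by linarith
    then show "1 / m \<le> 4 / sqrt n" using m by (simp add: frac_le_eq divide_le_0_iff field_simps)
  qed (use B_pos in simp)
  also have "\<dots> = 4 * B / sqrt n" by simp
  finally show ?thesis using that ij unfolding n_def by blast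
qed

lemma path_length_T_insert:
  "path_length T (u @ b # a # v) \<le> path_length T (u @ b # v) + 2 * T (a - b)"
proof (cases v)
  case Nil
  then show ?thesis using path_length_append[of T u b "[a]"] by simp
next
  case (Cons c w)
  then show ?thesis
    using path_length_append[of T u b "a # v"] path_length_append[of T u b v]
      T_triangle[of c a b] T_commute[of a b] by simp
qed

text \<open>One point of a close pair is removed and later reinserted right after its partner, a
  detour of at most \<open>8 * B / sqrt n\<close>. The constant 16 arises because the sum of
  \<open>1 / sqrt k\<close> for \<open>k\<close> up to \<open>n\<close> is at most
  \<open>2 * sqrt n\<close>.\<close>

lemma short_path:
  assumes "finite I" "\<And>i. i \<in> I \<Longrightarrow> x i \<in> cbox 0 1"
  shows "\<exists>is. distinct is \<and> set is = I \<and> path_length T (map x is) \<le> 16 * B * sqrt (card I)"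
  using assms
proof (induction "card I" arbitrary: I rule: less_induct)
  case less
  define n where "n = card I"
  show ?case
  proof (cases "card I \<le> 1")
    case True
    then consider "I = {}" | i where "I = {i}"
      using less.prems(1) by (metis One_nat_def card_0_eq card_1_singletonE le_Suc_eq le_zero_eq)
    then show ?thesis
    proof cases
      case 1
      then show ?thesis by (intro exI[of _ "[]"]) auto
    next
      case (2 i)
      then show ?thesis using B_pos by (intro exI[of _ "[i]"]) auto
    qed
  next
    case False
    then obtain i j where ij: "i \<in> I" "j \<in> I" "i \<noteq> j" "T (x i - x j) \<le> 4 * B / sqrt (card I)"
      using close_pair[of I x] less.prems(2) by (metis not_less_eq_eq numeral_2_eq_2 One_nat_def)
    have c: "card (I - {i}) = n - 1" using ij less.prems(1) by (simp add: n_def)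
    obtain "is" where "is": "distinct is" "set is = I - {i}"
      "path_length T (map x is) \<le> 16 * B * sqrt (card (I - {i}))"
      using less.hyps[of "I - {i}"] less.prems ij(1) by (metis Diff_iff card_Diff1_less finite_Diff)
    obtain u v where uv: "is = u @ j # v" using "is"(2) ij by (metis Diff_iff singletonD split_list)
    let ?js = "u @ j # i # v"
    have "path_length T (map x ?js) \<le> path_length T (map x is) + 2 * T (x i - x j)"
      using path_length_T_insert[of "map x u" "x j" "x i" "map x v"] by (simp add: uv)
    also have "\<dots> \<le> 16 * B * sqrt (real n - 1) + 8 * B / sqrt n"
      using "is"(3) ij(4) False unfolding c by (simp add: n_def of_nat_diff)
    also have "\<dots> \<le> 16 * B * sqrt n"
    proof -
      have n: "1 < real n" using False by (simp add: n_def)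
      \<comment> \<open>The inductive form of that sum bound is
        \<open>sqrt (n - 1) + 1 / (2 * sqrt n) \<le> sqrt n\<close>, which after multiplication by
        \<open>sqrt n\<close> is the inequality of arithmetic and geometric means for
        \<open>n - 1\<close> and \<open>n\<close>.\<close>
      have "sqrt (real n - 1) * sqrt n = sqrt ((real n - 1) * n)" by (simp add: real_sqrt_mult)
      also have "\<dots> \<le> (real n - 1 + n) / 2" using n by (intro arith_geo_mean_sqrt) auto
      finally have "sqrt (real n - 1) * sqrt n \<le> real n - 1 / 2" by simp
      have "sqrt (real n - 1) + 1 / (2 * sqrt n) = (sqrt (real n - 1) * sqrt n + 1 / 2) / sqrt n"
        using n by (simp add: field_simps)
      also have "\<dots> \<le> real n / sqrt n"
        using \<open>sqrt (real n - 1) * sqrt n \<le> real n - 1 / 2\<close> by (intro divide_right_mono) auto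
      also have "\<dots> = sqrt n" by (simp add: real_div_sqrt)
      finally have "sqrt (real n - 1) + 1 / (2 * sqrt n) \<le> sqrt n" .
      then have "16 * B * (sqrt (real n - 1) + 1 / (2 * sqrt n)) \<le> 16 * B * sqrt n"
        using B_pos by (intro mult_left_mono) auto
      then show ?thesis by (simp add: algebra_simps)
    qed
    finally have "path_length T (map x ?js) \<le> 16 * B * sqrt (card I)" by (simp add: n_def)
    moreover have "distinct ?js" "set ?js = I" using "is" ij(1) unfolding uv by auto
    ultimately show ?thesis by blast
  qed
qed

lemma opt_upper:
  assumes "finite I" "\<And>i. i \<in> I \<Longrightarrow> x i \<in> cbox 0 1"
  shows "opt x I \<le> 16 * B * sqrt (card I)"
proof -
  obtain "is" where "is": "distinct is" "set is = I" "path_length T (map x is) \<le> 16 * B * sqrt (card I)"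
    using short_path[of I x, OF assms] by blast
  show ?thesis
  proof (cases "is")
    case (Cons a ts)
    then have "opt x I \<le> plan_cost x [] [(a, ts, None)]"
      using assms(1) "is" by (intro opt_le) (auto simp: plans_def)
    also have "\<dots> = path_length T (map x is)" by (simp add: leg_def Cons)
    finally show ?thesis using "is"(3) by simp
  qed (use "is" in simp)
qed

text \<open>The new points get a plan of their own, of cost at most
  \<open>16 * B * sqrt (card F)\<close>; the link to it costs at most \<open>B\<close>, which is at
  most \<open>B * sqrt (card F)\<close> as soon as \<open>F\<close> is nonempty.\<close>

lemma opt_insert_set:
  assumes "finite I" "finite F" "I \<inter> F = {}" "\<And>i. i \<in> I \<union> F \<Longrightarrow> x i \<in> cbox 0 1"
  shows "opt x (I \<union> F) \<le> opt x I + 17 * B * sqrt (card F)"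
proof (cases "F = {}")
  case False
  have "opt x (I \<union> F) \<le> opt x I + opt x F + B"
    using assms B_pos by (intro opt_merge T_le_cube) auto
  moreover have "opt x F \<le> 16 * B * sqrt (card F)" using assms by (intro opt_upper) auto
  moreover have "1 \<le> card F" using False assms(2) by (simp add: Suc_leI card_gt_0_iff)
  then have "B * 1 \<le> B * sqrt (card F)" using B_pos by (intro mult_left_mono) auto
  ultimately show ?thesis by simp
qed simp

lemma opt_delete_set:
  assumes "finite I" "F \<subseteq> I" "\<And>i. i \<in> I \<Longrightarrow> x i \<in> cbox 0 1"
  shows "opt x (I - F) \<le> opt x I + 34 * B * sqrt (card F)"
proof -
  obtain g where g: "g \<in> plans I" "opt x I = plan_cost x [] g" using opt_attained assms(1) by metis
  have "finite F" using assms finite_subset by blast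
  then obtain h where h: "distinct (plan_nodes h)" "set (plan_nodes h) \<subseteq> I - F"
    "card (I - set (plan_nodes h)) \<le> 3 * card F" "plan_cost x [] h \<le> opt x I"
    using plan_delete_set[of F g x] g by (auto simp: plans_def)
  let ?A = "set (plan_nodes h)"
  have "card (I - F - ?A) \<le> card (I - ?A)" using assms(1) by (intro card_mono) auto
  then have "card (I - F - ?A) \<le> 3 * card F" using h(3) by linarith
  \<comment> \<open>The 3 is rounded up to the square 4, so that reinserting the survivors costs
    twice the insertion bound, whence \<open>34 = 2 * 17\<close>.\<close>
  then have "sqrt (card (I - F - ?A)) \<le> sqrt (2\<^sup>2 * card F)" by (intro real_sqrt_le_mono) simp
  also have "\<dots> = 2 * sqrt (card F)" by (simp add: real_sqrt_mult)
  finally have s: "sqrt (card (I - F - ?A)) \<le> 2 * sqrt (card F)" .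
  have "opt x (I - F) = opt x (?A \<union> (I - F - ?A))" using h(2) by (simp add: Un_absorb1)
  also have "\<dots> \<le> opt x ?A + 17 * B * sqrt (card (I - F - ?A))"
    using assms h(2) by (intro opt_insert_set) auto
  also have "opt x ?A \<le> plan_cost x [] h" using h(1) by (intro opt_le) (auto simp: plans_def)
  also have "17 * B * sqrt (card (I - F - ?A)) \<le> 17 * B * (2 * sqrt (card F))"
    using B_pos s by (intro mult_left_mono) auto
  finally show ?thesis using h(4) by simp
qed

text \<open>Any multiple of \<open>B\<close> that is at least \<open>(17 + 34) * B\<close>, the sum
  of the constants for insertion and deletion, would do.\<close>

definition L :: real where "L = 70 * B"

lemma L_pos: "0 < L" using B_pos by (simp add: L_def)

text \<open>The passage from \<open>J\<close> to \<open>I\<close> goes through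
  \<open>I \<inter> J\<close>: the points of \<open>J - I\<close> are deleted, then those of
  \<open>I - J\<close> are inserted.\<close>

lemma opt_smooth_le:
  assumes "finite I" "finite J" "\<And>i. i \<in> I \<union> J \<Longrightarrow> x i \<in> cbox 0 1"
  shows "opt x I \<le> opt x J + L * sqrt (card ((I - J) \<union> (J - I)))"
proof -
  let ?s = "sqrt (card ((I - J) \<union> (J - I)))"
  have "card (I - J) \<le> card ((I - J) \<union> (J - I))" "card (J - I) \<le> card ((I - J) \<union> (J - I))"
    using assms by (auto intro!: card_mono)
  then have s: "sqrt (card (I - J)) \<le> ?s" "sqrt (card (J - I)) \<le> ?s" by simp_all
  have "opt x I = opt x ((I \<inter> J) \<union> (I - J))" by (simp add: Int_Diff_Un)
  also have "\<dots> \<le> opt x (I \<inter> J) + 17 * B * sqrt (card (I - J))"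
    using assms by (intro opt_insert_set) auto
  also have "opt x (I \<inter> J) = opt x (J - (J - I))" by (simp add: Int_commute Diff_Diff_Int)
  also have "\<dots> \<le> opt x J + 34 * B * sqrt (card (J - I))"
    using assms by (intro opt_delete_set) auto
  also have "34 * B * sqrt (card (J - I)) \<le> 34 * B * ?s" using s B_pos by (intro mult_left_mono) auto
  also have "17 * B * sqrt (card (I - J)) \<le> 17 * B * ?s" using s B_pos by (intro mult_left_mono) auto
  finally have "opt x I \<le> opt x J + 51 * (B * ?s)" by simp
  moreover have "0 \<le> B * ?s" using B_pos by simp
  ultimately show ?thesis unfolding L_def by linarith
qed

lemma opt_smooth:
  assumes "finite I" "finite J" "\<And>i. i \<in> I \<union> J \<Longrightarrow> x i \<in> cbox 0 1"
  shows "\<bar>opt x I - opt x J\<bar> \<le> L * sqrt (card ((I - J) \<union> (J - I)))"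
proof -
  have "opt x I \<le> opt x J + L * sqrt (card ((I - J) \<union> (J - I)))"
    using assms by (rule opt_smooth_le)
  moreover have "opt x J \<le> opt x I + L * sqrt (card ((J - I) \<union> (I - J)))"
    using assms by (intro opt_smooth_le) auto
  ultimately show ?thesis by (simp only: Un_commute[of "J - I"] abs_le_iff) linarith
qed

text \<open>The plans of the cells are concatenated in the order of a short path through
  representatives of the cells.\<close>

lemma opt_grid:
  assumes I: "finite I" "\<And>i. i \<in> I \<Longrightarrow> x i \<in> cbox 0 1"
    and \<delta>: "0 \<le> \<delta>" "\<And>i j. i \<in> I \<Longrightarrow> j \<in> I \<Longrightarrow> lab i = lab j \<Longrightarrow> T (x i - x j) \<le> \<delta>"
  shows "opt x I \<le> (\<Sum>q\<in>lab ` I. opt x {i \<in> I. lab i = q}) + 16 * B * sqrt (card (lab ` I))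
    + 2 * \<delta> * card (lab ` I)"
proof -
  define C where "C q = {i \<in> I. lab i = q}" for q
  have finC: "finite (C q)" for q using I(1) by (simp add: C_def)
  \<comment> \<open>The invariant that the plan starts inside the cell of \<open>hd ks\<close> makes
    the next link affordable: from any node of the cell of \<open>k\<close> to the start
    \<open>b\<close> in the cell of \<open>k'\<close> one can go via the representatives
    \<open>k\<close> and \<open>k'\<close>, at cost \<open>T (x k' - x k) + 2 * \<delta>\<close>.
    The first summands add up to the path through the representatives.\<close>
  have chain: "\<exists>g \<in> plans (\<Union>k\<in>set ks. C (lab k)).
      plan_cost x [] g \<le> (\<Sum>k\<leftarrow>ks. opt x (C (lab k))) + path_length T (map x ks) + 2 * \<delta> * length ks \<and>
      (ks \<noteq> [] \<longrightarrow> (\<exists>b \<in> C (lab (hd ks)). next_start g [] = [b]))"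
    if "set ks \<subseteq> I" "distinct (map lab ks)" for ks
    using that
  proof (induction ks)
    case Nil
    then show ?case by (intro bexI[of _ "[]"]) (auto simp: plans_def)
  next
    case (Cons k ks)
    obtain g0 where g0: "g0 \<in> plans (C (lab k))" "opt x (C (lab k)) = plan_cost x [] g0"
      using opt_attained finC by metis
    have "k \<in> C (lab k)" using Cons.prems by (auto simp: C_def)
    then have "g0 \<noteq> []" using g0(1) by (auto simp: plans_def)
    then obtain s g0' where s: "g0 = s # g0'" by (cases g0) auto
    then have fs: "fst s \<in> C (lab k)" using g0(1) fst_in_seg_nodes[of s] by (auto simp: plans_def)
    obtain g where g: "g \<in> plans (\<Union>k\<in>set ks. C (lab k))"
      "plan_cost x [] g \<le> (\<Sum>k\<leftarrow>ks. opt x (C (lab k))) + path_length T (map x ks) + 2 * \<delta> * length ks"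
      "ks \<noteq> [] \<Longrightarrow> \<exists>b \<in> C (lab (hd ks)). next_start g [] = [b]"
      using Cons by auto
    show ?case
    proof (cases ks)
      case Nil
      then show ?thesis using g0 fs \<delta>(1) by (intro bexI[of _ g0]) (auto simp: s)
    next
      case (Cons k' ks')
      then obtain b where b: "b \<in> C (lab k')" "next_start g [] = [b]" using g(3) by auto
      have k': "k' \<in> I" "k \<in> I" using Cons.prems Cons by auto
      have "C (lab k) \<inter> C (lab l) = {}" if "l \<in> set ks" for l
      proof -
        have "lab k \<noteq> lab l" using Cons.prems that by auto
        then show ?thesis by (auto simp: C_def)
      qed
      then have gg: "g0 @ g \<in> plans (\<Union>k\<in>set (k # ks). C (lab k))"
        using g0(1) g(1) by (auto simp: plans_def)
      have "T (x b - x i) \<le> T (x k' - x k) + 2 * \<delta>" if "i \<in> C (lab k)" for i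
      proof -
        have "T (x b - x k') \<le> \<delta>" "T (x k - x i) \<le> \<delta>"
          using \<delta>(2) b(1) that k' by (auto simp: C_def)
        then show ?thesis
          using T_triangle[of "x b" "x i" "x k'"] T_triangle[of "x k'" "x i" "x k"] by linarith
      qed
      then have "plan_cost x [] (g0 @ g) \<le> plan_cost x [] g0 + plan_cost x [] g + (T (x k' - x k) + 2 * \<delta>)"
        using g0(1) \<delta>(1) b(2) by (intro plan_cost_concat[of _ _ b]) (auto simp: plans_def)
      then have "plan_cost x [] (g0 @ g) \<le> (\<Sum>k\<leftarrow>k # ks. opt x (C (lab k)))
          + path_length T (map x (k # ks)) + 2 * \<delta> * length (k # ks)"
        using g0(2) g(2) by (simp add: Cons algebra_simps)
      moreover have "next_start (g0 @ g) [] = [fst s]" by (simp add: s)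
      ultimately show ?thesis using gg fs by (intro bexI[of _ "g0 @ g"]) auto
    qed
  qed
  define r where "r = inv_into I lab"
  have r: "r q \<in> I" "lab (r q) = q" if "q \<in> lab ` I" for q
    using that by (auto simp: r_def inv_into_into f_inv_into_f)
  have inj: "inj_on r (lab ` I)" by (rule inj_on_inverseI[of _ lab]) (use r in auto)
  obtain ks where ks: "distinct ks" "set ks = r ` lab ` I"
    "path_length T (map x ks) \<le> 16 * B * sqrt (card (r ` lab ` I))"
    using short_path[of "r ` lab ` I" x] I r by blast
  have "(\<lambda>q. lab (r q)) ` lab ` I = (\<lambda>q. q) ` lab ` I" by (rule image_cong[OF refl]) (rule r(2))
  then have labs: "lab ` set ks = lab ` I" unfolding ks(2) by (simp add: image_image)
  have c: "card (r ` lab ` I) = card (lab ` I)" by (rule card_image[OF inj])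
  have len: "length ks = card (lab ` I)" using ks distinct_card c by metis
  have dl: "distinct (map lab ks)"
    using ks(1) len labs by (simp add: card_distinct)
  have sub: "set ks \<subseteq> I" using ks(2) r by auto
  obtain g where g: "g \<in> plans (\<Union>k\<in>set ks. C (lab k))"
    "plan_cost x [] g \<le> (\<Sum>k\<leftarrow>ks. opt x (C (lab k))) + path_length T (map x ks) + 2 * \<delta> * length ks"
    using chain[OF sub dl] by blast
  have "(\<Union>k\<in>set ks. C (lab k)) = (\<Union>q\<in>lab ` I. C q)" unfolding labs[symmetric] by simp
  also have "\<dots> = I" by (auto simp: C_def)
  finally have "opt x I \<le> plan_cost x [] g" using g(1) I(1) by (simp add: opt_le)
  moreover have "(\<Sum>k\<leftarrow>ks. opt x (C (lab k))) = (\<Sum>q\<in>lab ` I. opt x (C q))"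
    using sum_list_distinct_conv_sum_set[OF dl, of "\<lambda>q. opt x (C q)"] labs by (simp add: comp_def)
  ultimately show ?thesis using g(2) ks(3) c len by (simp add: C_def)
qed

section \<open>The makespan differs from the open cost by a bounded amount\<close>

lemma ring_cost_le_leg:
  "ring_cost T D (Ring a b (set ts) d) \<le> leg id (a, ts, d) [b]" if "distinct ts"
proof -
  have "a # ts @ [b] \<in> truck_paths (Ring a b (set ts) d)"
    using that by (auto simp: truck_paths_def permutations_of_set_def)
  moreover have "finite (truck_paths (Ring a b (set ts) d))" by (simp add: truck_paths_def)
  ultimately have "ring_cost T D (Ring a b (set ts) d) \<le> (case d of
       None \<Rightarrow> path_length T (a # ts @ [b])
     | Some p \<Rightarrow> max (path_length T (a # ts @ [b])) (path_length D [a, p, b]))"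
    unfolding ring_cost_def
    by (intro Min_le finite_imageI image_eqI[where x = "a # ts @ [b]"]) (auto split: option.splits)
  also have "\<dots> \<le> leg id (a, ts, d) [b]"
    by (auto simp: leg_def split: option.splits)
  finally show ?thesis .
qed

lemma sum_ring_cost_le:
  assumes "distinct (plan_nodes g)"
  shows "(\<Sum>r\<leftarrow>plan_rings g e. ring_cost T D r) \<le> plan_cost id [e] g"
  using assms
proof (induction g e rule: plan_rings.induct)
  case (2 a ts d g e)
  define b where "b = (case g of [] \<Rightarrow> e | s # _ \<Rightarrow> fst s)"
  have "next_start g [e] = [b]" by (cases g) (auto simp: b_def)
  moreover have "ring_cost T D (Ring a b (set ts) d) \<le> leg id (a, ts, d) [b]"
    using 2 by (intro ring_cost_le_leg) (auto simp: seg_nodes_def)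
  moreover have "distinct (plan_nodes g)" using 2(2) by simp
  then have "(\<Sum>r\<leftarrow>plan_rings g e. ring_cost T D r) \<le> plan_cost id [e] g" by (rule 2(1))
  ultimately show ?case
    unfolding plan_rings.simps plan_cost.simps list.map sum_list.Cons b_def[symmetric]
    by (metis add_mono)
qed simp

lemma ring_cost_attained:
  assumes "is_ring r"
  obtains ts where "distinct ts" "set ts = truck_nodes r"
    "ring_cost T D r = leg id (start_node r, ts, drone_node r) [end_node r]"
proof -
  let ?f = "\<lambda>p. case drone_node r of None \<Rightarrow> path_length T p
     | Some d \<Rightarrow> max (path_length T p) (path_length D [start_node r, d, end_node r])"
  have "ring_cost T D r \<in> ?f ` truck_paths r"
    unfolding ring_cost_def using truck_paths_finite_nonempty[OF assms] by (intro Min_in) auto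
  then obtain ts where ts: "ts \<in> permutations_of_set (truck_nodes r)"
    "ring_cost T D r = ?f (start_node r # ts @ [end_node r])"
    by (auto simp: truck_paths_def)
  have "ring_cost T D r = leg id (start_node r, ts, drone_node r) [end_node r]"
    unfolding ts(2) leg_def using path_length_T_nonneg
    by (auto split: option.splits simp: max_absorb1 simp del: path_length.simps)
  then show ?thesis using that ts(1) by (auto simp: permutations_of_set_def)
qed

text \<open>An optimal set of rings, each with an optimal truck order, is cut open at the start of
  its first listed ring. The plan closed at that node has exactly the makespan as its cost, and
  leaving its end open does not increase the cost.\<close>

lemma opt_le_TSPD:
  assumes "finite X"
  shows "opt id X \<le> TSPD T D X"
proof (cases "card X \<le> 1")
  case True
  then consider "X = {}" | p where "X = {p}"
    using assms by (metis One_nat_def card_0_eq card_1_singletonE le_Suc_eq le_zero_eq)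
  then show ?thesis
  proof cases
    case (2 p)
    then show ?thesis using opt_le[of "{p}" "[(p, [], None)]" id] by (simp add: TSPD_def plans_def leg_def)
  qed (simp add: TSPD_def)
next
  case False
  have "TSPD T D X \<in> (\<lambda>R. \<Sum>r\<in>R. ring_cost T D r) ` {R. feasible_solution X R}"
    unfolding TSPD_def
    using False finite_feasible_solutions[OF assms] feasible_solution_exists[OF assms]
    by (auto intro!: Min_in simp del: Min_in)
  then obtain R where R: "feasible_solution X R" "TSPD T D X = (\<Sum>r\<in>R. ring_cost T D r)" by blast
  then obtain rs where rs: "rs \<noteq> []" "set rs = R" "distinct (map start_node rs)"
     "map end_node rs = rotate1 (map start_node rs)"
    unfolding feasible_solution_def cyclic_tour_def by blast
  have "\<forall>r\<in>R. \<exists>ts. distinct ts \<and> set ts = truck_nodes r \<and>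
    ring_cost T D r = leg id (start_node r, ts, drone_node r) [end_node r]"
    using R(1) ring_cost_attained unfolding feasible_solution_def by metis
  then obtain p where p: "\<And>r. r \<in> R \<Longrightarrow> distinct (p r)" "\<And>r. r \<in> R \<Longrightarrow> set (p r) = truck_nodes r"
    "\<And>r. r \<in> R \<Longrightarrow> ring_cost T D r = leg id (start_node r, p r, drone_node r) [end_node r]"
    by metis
  define sg where "sg r = (start_node r, p r, drone_node r)" for r
  have seg: "set (seg_nodes (sg r)) = insert (start_node r) (inner_nodes r)" "distinct (seg_nodes (sg r))"
    if "r \<in> R" for r
    using p[OF that] R(1) that
    by (auto simp: seg_nodes_def sg_def inner_nodes_def feasible_solution_def is_ring_def split: option.splits)
  have nodes: "distinct (plan_nodes (map sg qs))" if "set qs \<subseteq> R" "distinct (map start_node qs)" for qs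
    using that
  proof (induction qs)
    case (Cons q qs)
    have "set (seg_nodes (sg q)) \<inter> set (seg_nodes (sg r)) = {}" if "r \<in> set qs" for r
    proof -
      have "start_node q \<notin> start_node ` set qs" using Cons.prems by auto
      then have r: "r \<in> R" "q \<in> R" "start_node r \<noteq> start_node q"
        using that Cons.prems by (auto simp: image_iff)
      then have "inner_nodes q \<inter> inner_nodes r = {}"
        using R(1) unfolding feasible_solution_def disjoint_family_on_def by metis
      moreover have "start_node r \<notin> inner_nodes q" "start_node q \<notin> inner_nodes r"
        using R(1) r unfolding feasible_solution_def by blast+
      ultimately show ?thesis using r seg by auto
    qed
    then have "set (seg_nodes (sg q)) \<inter> set (plan_nodes (map sg qs)) = {}"
      by (auto simp: plan_nodes_def)
    then show ?case using Cons seg by auto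
  qed simp
  have "set (plan_nodes (map sg rs)) = X"
    using R(1) seg rs(2) unfolding feasible_solution_def by (auto simp: plan_nodes_def)
  then have "map sg rs \<in> plans X" using nodes[of rs] rs by (auto simp: plans_def)
  then have "opt id X \<le> plan_cost id [] (map sg rs)" using assms by (intro opt_le)
  also have "\<dots> \<le> plan_cost id [start_node (hd rs)] (map sg rs)" by (rule plan_cost_open_le)
  also have "\<dots> = (\<Sum>r\<leftarrow>rs. ring_cost T D r)"
  proof -
    \<comment> \<open>The end \<open>e\<close> is kept arbitrary because a proper suffix of the
      cyclic list of rings is not itself cyclic.\<close>
    have cost: "plan_cost id [e] (map sg qs) = (\<Sum>r\<leftarrow>qs. ring_cost T D r)"
      if "set qs \<subseteq> R" "qs \<noteq> []" "map end_node qs = tl (map start_node qs) @ [e]" for qs e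
      using that
    proof (induction qs)
      case (Cons q qs)
      then have "next_start (map sg qs) [e] = [end_node q]"
        by (cases qs) (auto simp: sg_def)
      then have leg: "leg id (sg q) (next_start (map sg qs) [e]) = ring_cost T D q"
        using p(3)[of q] Cons.prems by (simp add: sg_def)
      have rest: "plan_cost id [e] (map sg qs) = (\<Sum>r\<leftarrow>qs. ring_cost T D r)"
      proof (cases "qs = []")
        case False
        with Cons.prems have "map end_node qs = tl (map start_node qs) @ [e]" by (cases qs) auto
        then show ?thesis using Cons.prems False by (intro Cons.IH) auto
      qed simp
      show ?case by (simp only: list.map plan_cost.simps leg rest sum_list.Cons)
    qed simp
    show ?thesis
      using rs by (intro cost) (cases rs; auto)+
  qed
  also have "\<dots> = TSPD T D X"
    using rs R(2) sum_list_distinct_conv_sum_set[of rs "ring_cost T D"] by (simp add: distinct_map)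
  finally show ?thesis .
qed

text \<open>The constant consists of \<open>2 * B\<close> for reaching at least two combined nodes
  and \<open>B\<close> for the edges that close the tour.\<close>

lemma TSPD_le_opt:
  assumes "finite X" "X \<subseteq> cbox 0 1"
  shows "TSPD T D X \<le> opt id X + 3 * B"
proof (cases "card X \<le> 1")
  case True
  then show ?thesis using opt_nonneg[OF assms(1), of id] B_pos by (simp add: TSPD_def)
next
  case False
  obtain g where g: "g \<in> plans X" "opt id X = plan_cost id [] g" using opt_attained assms(1) by metis
  have TB: "T (v - w) \<le> B" and DB: "D (v - w) \<le> B" if "v \<in> X" "w \<in> X" for v w
    using T_le_cube D_le_T[of "v - w"] assms that by (meson order_trans subsetD)+
  have "\<exists>h \<in> plans X. 2 \<le> length h \<and> plan_cost id [] h \<le> plan_cost id [] g + 2 * B"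
  proof (cases "2 \<le> length g")
    case True
    then show ?thesis using g B_pos by (intro bexI[of _ g]) auto
  next
    case short: False
    have "g \<noteq> []" using g(1) False by (auto simp: plans_def)
    then obtain a ts d where gs: "g = [(a, ts, d)]"
      using short by (cases g; cases "tl g") auto
    have X: "X = set (seg_nodes (a, ts, d))" "distinct (seg_nodes (a, ts, d))"
      using g(1) by (auto simp: gs plans_def)
    show ?thesis
    \<comment> \<open>A single ring has to be split in two. Without truck nodes the drone node
      becomes a combined node. Otherwise the first truck node \<open>b\<close> does; the drone is
      then served between \<open>a\<close> and \<open>b\<close>, on a path of length at most
      \<open>2 * B\<close>, and the rest of the truck path is unchanged.\<close>
    proof (cases ts)
      case Nil
      then obtain p where d: "d = Some p" using False X by (cases d) auto
      let ?h = "[(a, [], None), (p, [], None)]"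
      have "?h \<in> plans X" using X by (auto simp: plans_def d Nil)
      moreover have "plan_cost id [] ?h \<le> B" using TB[of p a] X by (auto simp: leg_def d Nil)
      ultimately show ?thesis
        using B_pos plan_cost_nonneg[of id "[]" g] by (intro bexI[of _ ?h]) (auto simp del: plan_cost_nonneg)
    next
      case (Cons b us)
      let ?h = "[(a, [], d), (b, us, None)]"
      have "?h \<in> plans X" using X by (auto simp: plans_def Cons seg_nodes_def)
      moreover have "plan_cost id [] ?h \<le> plan_cost id [] g + 2 * B"
      proof -
        have "leg id (a, [], d) [b] \<le> 2 * B"
          using TB[of b a] DB[of _ a] DB[of b] X Cons B_pos
          by (auto simp: leg_def seg_nodes_def intro!: add_mono[of _ B _ B, simplified] split: option.splits)
        moreover have "path_length T (b # us) \<le> plan_cost id [] g"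
          using T_path_le_leg[of id a ts "[]" d] T_nonneg[of "b - a"] unfolding gs Cons
          by (simp del: T_nonneg)
        moreover have "leg id (b, us, None) [] = path_length T (b # us)" by (simp add: leg_def)
        ultimately show ?thesis by simp
      qed
      ultimately show ?thesis by (intro bexI[of _ ?h]) auto
    qed
  qed
  then obtain h where h: "h \<in> plans X" "2 \<le> length h" "plan_cost id [] h \<le> opt id X + 2 * B"
    using g by auto
  let ?e = "fst (hd h)"
  have "TSPD T D X \<le> (\<Sum>r\<in>set (plan_rings h ?e). ring_cost T D r)"
    unfolding TSPD_def using False finite_feasible_solutions[OF assms(1)] feasible_plan_rings[OF h(1,2)]
    by (auto intro!: Min_le)
  also have "\<dots> = (\<Sum>r\<leftarrow>plan_rings h ?e. ring_cost T D r)"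
  proof -
    have "distinct (map start_node (plan_rings h ?e))"
      unfolding map_start_plan_rings using h(1) by (auto simp: plans_def intro: distinct_starts)
    then show ?thesis using sum_list_distinct_conv_sum_set[of "plan_rings h ?e" "ring_cost T D"] by (simp add: distinct_map)
  qed
  also have "\<dots> \<le> plan_cost id [?e] h" using h(1) by (intro sum_ring_cost_le) (simp add: plans_def)
  also have "\<dots> \<le> plan_cost id [] h + B"
  proof (rule plan_cost_extend)
    have "?e \<in> X" using h(1,2) fst_in_seg_nodes[of "hd h"] by (cases h) (auto simp: plans_def)
    then show "T (id ?e - id i) \<le> B" if "i \<in> set (plan_nodes h)" for i
      using that h(1) TB by (auto simp: plans_def)
  qed (use B_pos in simp)
  finally show ?thesis using h(3) by simp
qed

end

section \<open>Lipschitz regularization of set functions\<close>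

text \<open>A sup-convolution over subsets, with penalty \<open>c\<close> for each omitted
  element.\<close>

definition upper_reg :: "real \<Rightarrow> ('i set \<Rightarrow> real) \<Rightarrow> 'i set \<Rightarrow> real" where
  "upper_reg c h A = Max ((\<lambda>K. h K - c * real (card (A - K))) ` Pow A)"

text \<open>The corresponding inf-convolution.\<close>

definition lower_reg :: "real \<Rightarrow> ('i set \<Rightarrow> real) \<Rightarrow> 'i set \<Rightarrow> real" where
  "lower_reg c h A = Min ((\<lambda>K. h K + c * real (card (A - K))) ` Pow A)"

lemma upper_reg_ge: "finite A \<Longrightarrow> K \<subseteq> A \<Longrightarrow> h K - c * real (card (A - K)) \<le> upper_reg c h A"
  unfolding upper_reg_def by (intro Max_ge) auto

lemma lower_reg_le: "finite A \<Longrightarrow> K \<subseteq> A \<Longrightarrow> lower_reg c h A \<le> h K + c * real (card (A - K))"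
  unfolding lower_reg_def by (intro Min_le) auto

lemma upper_reg_attained:
  assumes "finite A"
  obtains K where "K \<subseteq> A" "upper_reg c h A = h K - c * real (card (A - K))"
proof -
  have "upper_reg c h A \<in> (\<lambda>K. h K - c * real (card (A - K))) ` Pow A"
    unfolding upper_reg_def using assms by (intro Max_in) auto
  then show ?thesis using that by auto
qed

lemma lower_reg_attained:
  assumes "finite A"
  obtains K where "K \<subseteq> A" "lower_reg c h A = h K + c * real (card (A - K))"
proof -
  have "lower_reg c h A \<in> (\<lambda>K. h K + c * real (card (A - K))) ` Pow A"
    unfolding lower_reg_def using assms by (intro Min_in) auto
  then show ?thesis using that by auto
qed

lemma upper_reg_remove_le:
  assumes "finite A" "i \<in> A"
  shows "upper_reg c h (A - {i}) \<le> upper_reg c h A + c"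
proof -
  obtain K where K: "K \<subseteq> A - {i}" "upper_reg c h (A - {i}) = h K - c * real (card (A - {i} - K))"
    using upper_reg_attained[of "A - {i}"] assms by blast
  have "A - K = insert i (A - {i} - K)" using K(1) assms(2) by auto
  then have "card (A - K) = Suc (card (A - {i} - K))" using assms by simp
  then show ?thesis
    using upper_reg_ge[OF assms(1), of K h c] K subset_trans[OF K(1) Diff_subset]
    by (simp add: algebra_simps)
qed

text \<open>Regularizing from above makes deletions cheap and regularizing from below makes insertions
  cheap while keeping deletions cheap, so the two together give a function that is Lipschitz for
  the cardinality of the symmetric difference.\<close>

lemma lower_upper_reg_remove:
  fixes h :: "'i set \<Rightarrow> real"
  assumes "finite A" "i \<in> A" "0 \<le> c"
  defines "H \<equiv> lower_reg c (upper_reg c h)"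
  shows "\<bar>H A - H (A - {i})\<bar> \<le> c"
proof -
  have "H A \<le> H (A - {i}) + c"
  proof -
    obtain K where K: "K \<subseteq> A - {i}" "H (A - {i}) = upper_reg c h K + c * real (card (A - {i} - K))"
      unfolding H_def using lower_reg_attained[of "A - {i}"] assms(1) by blast
    have "A - K = insert i (A - {i} - K)" using K(1) assms(2) by auto
    then have "card (A - K) = Suc (card (A - {i} - K))" using assms(1) by simp
    then show ?thesis
      using lower_reg_le[of A K c "upper_reg c h"] K assms(1) unfolding H_def by (auto simp: algebra_simps)
  qed
  moreover have "H (A - {i}) \<le> H A + c"
  proof -
    obtain K where K: "K \<subseteq> A" "H A = upper_reg c h K + c * real (card (A - K))"
      unfolding H_def using lower_reg_attained assms(1) by blast
    have fin: "finite K" using K(1) assms(1) finite_subset by blast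
    \<comment> \<open>The competitor is the minimizer \<open>K\<close> without \<open>i\<close>. If
      \<open>i \<in> K\<close>, the penalty stays the same and the deletion inside
      \<open>upper_reg\<close> costs at most \<open>c\<close>; if \<open>i \<notin> K\<close>, the
      penalty can only decrease.\<close>
    have H: "H (A - {i}) \<le> upper_reg c h (K - {i}) + c * real (card (A - {i} - (K - {i})))"
      unfolding H_def using K(1) assms(1) by (intro lower_reg_le) auto
    show ?thesis
    proof (cases "i \<in> K")
      case True
      then have "A - {i} - (K - {i}) = A - K" by auto
      then show ?thesis using H K(2) upper_reg_remove_le[OF fin True, of c h] by simp
    next
      case False
      then have "card (A - {i} - (K - {i})) \<le> card (A - K)"
        using assms(1) by (intro card_mono) auto
      then have "c * real (card (A - {i} - (K - {i}))) \<le> c * real (card (A - K))"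
        using assms(3) by (intro mult_left_mono) auto
      then show ?thesis using H K(2) False assms(3) by simp
    qed
  qed
  ultimately show ?thesis by linarith
qed

text \<open>Omitting \<open>k\<close> elements gains at most \<open>C * sqrt k\<close> and is
  charged \<open>c * k\<close>. The difference is at most \<open>C\<^sup>2 / (4 * c)\<close>, by
  completing the square around \<open>sqrt k = C / (2 * c)\<close>. The inner regularization only
  raises \<open>h\<close> and the outer one only lowers the result, so the two errors do not add
  up.\<close>

lemma lower_upper_reg_close:
  assumes "finite A" "0 < c"
    and smooth: "\<And>K J. K \<subseteq> J \<Longrightarrow> J \<subseteq> A \<Longrightarrow> \<bar>h J - h K\<bar> \<le> C * sqrt (card (J - K))"
  shows "\<bar>lower_reg c (upper_reg c h) A - h A\<bar> \<le> C\<^sup>2 / (4 * c)"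
proof -
  have amgm: "C * sqrt k - c * k \<le> C\<^sup>2 / (4 * c)" for k :: nat
  proof -
    have "0 \<le> (C - 2 * c * sqrt k)\<^sup>2" by simp
    also have "\<dots> = C\<^sup>2 - 4 * c * (C * sqrt k) + 4 * c * (c * (sqrt k)\<^sup>2)"
      by (simp add: power2_eq_square algebra_simps)
    finally have "4 * c * (C * sqrt k - c * k) \<le> C\<^sup>2" by (simp add: algebra_simps)
    then show ?thesis using assms(2) by (simp add: field_simps)
  qed
  have ge: "h J \<le> upper_reg c h J" if "J \<subseteq> A" for J
    using upper_reg_ge[of J J h c] finite_subset[OF that assms(1)] by simp
  have "upper_reg c h A \<le> h A + C\<^sup>2 / (4 * c)"
  proof -
    obtain K where K: "K \<subseteq> A" "upper_reg c h A = h K - c * real (card (A - K))"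
      using upper_reg_attained assms(1) by blast
    then show ?thesis using smooth[OF K(1) order_refl] amgm[of "card (A - K)"] by linarith
  qed
  moreover have "lower_reg c (upper_reg c h) A \<le> upper_reg c h A"
    using lower_reg_le[of A A c "upper_reg c h"] assms(1) by simp
  moreover have "h A - C\<^sup>2 / (4 * c) \<le> lower_reg c (upper_reg c h) A"
  proof -
    obtain K where K: "K \<subseteq> A" "lower_reg c (upper_reg c h) A = upper_reg c h K + c * real (card (A - K))"
      using lower_reg_attained assms(1) by blast
    then show ?thesis using smooth[OF K(1) order_refl] amgm[of "card (A - K)"] ge[OF K(1)] by linarith
  qed
  ultimately show ?thesis by linarith
qed

lemma upper_reg_cong: "(\<And>K. K \<subseteq> A \<Longrightarrow> h K = h' K) \<Longrightarrow> upper_reg c h A = upper_reg c h' A"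
  unfolding upper_reg_def by (intro arg_cong[where f = Max] image_cong) auto

lemma lower_upper_reg_cong:
  assumes "\<And>K. K \<subseteq> A \<Longrightarrow> h K = h' K"
  shows "lower_reg c (upper_reg c h) A = lower_reg c (upper_reg c h') A"
proof -
  have "upper_reg c h J = upper_reg c h' J" if "J \<subseteq> A" for J
    using that assms by (intro upper_reg_cong) auto
  then show ?thesis unfolding lower_reg_def by (intro arg_cong[where f = Min] image_cong) auto
qed

lemma lower_upper_reg_measurable:
  assumes "finite A" "\<And>K. K \<subseteq> A \<Longrightarrow> (\<lambda>x. h x K) \<in> borel_measurable M"
  shows "(\<lambda>x. lower_reg c (upper_reg c (h x)) A) \<in> borel_measurable M"
proof -
  have "(\<lambda>x. upper_reg c (h x) J) \<in> borel_measurable M" if "J \<subseteq> A" for J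
    unfolding upper_reg_def
  proof (rule borel_measurable_Max)
    show "finite (Pow J)" using finite_subset[OF that assms(1)] by simp
    show "(\<lambda>x. h x K - c * real (card (J - K))) \<in> borel_measurable M" if "K \<in> Pow J" for K
      using assms(2)[of K] that \<open>J \<subseteq> A\<close> by (intro borel_measurable_diff) auto
  qed
  then show ?thesis
    unfolding lower_reg_def using assms(1)
    by (intro borel_measurable_Min[of "Pow A"] borel_measurable_add) auto
qed

section \<open>Integration over product spaces\<close>

text \<open>The induction integrates out one coordinate at a time. The partial mean \<open>g\<close>
  inherits the bound and the bounded differences, and Hoeffding's lemma for the integrated
  coordinate supplies one factor \<open>exp (l\<^sup>2 * c\<^sup>2 / 2)\<close>.\<close>

lemma McDiarmid_mgf:
  fixes f :: "('i \<Rightarrow> 'a) \<Rightarrow> real" and c :: real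
  assumes \<mu>: "prob_space \<mu>" and "finite I" "f \<in> borel_measurable (PiM I (\<lambda>_. \<mu>))" "0 < l"
    and "\<And>x. x \<in> space (PiM I (\<lambda>_. \<mu>)) \<Longrightarrow> \<bar>f x\<bar> \<le> C"
    and "\<And>x i y. x \<in> space (PiM I (\<lambda>_. \<mu>)) \<Longrightarrow> i \<in> I \<Longrightarrow> y \<in> space \<mu> \<Longrightarrow> \<bar>f (x(i := y)) - f x\<bar> \<le> c"
  shows "(\<integral>\<^sup>+x. exp (l * (f x - integral\<^sup>L (PiM I (\<lambda>_. \<mu>)) f)) \<partial>PiM I (\<lambda>_. \<mu>))
    \<le> exp (l\<^sup>2 * c\<^sup>2 / 2 * card I)"
  using assms(2,3,5,6)
proof (induction I arbitrary: f rule: finite_induct)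
  case empty
  show ?case by (simp add: PiM_empty nn_integral_count_space_finite lebesgue_integral_count_space_finite)
next
  case (insert i I f)
  interpret \<mu>: prob_space \<mu> by (rule \<mu>)
  interpret product_sigma_finite "\<lambda>_::'i. \<mu>" by unfold_locales
  let ?P = "PiM I (\<lambda>_. \<mu>)" and ?P' = "PiM (insert i I) (\<lambda>_. \<mu>)"
  interpret PI: prob_space ?P by (rule prob_space_PiM) (rule \<mu>)
  interpret PI': prob_space ?P' by (rule prob_space_PiM) (rule \<mu>)
  note [measurable] = insert.prems(1)
  have upd: "x(i := y) \<in> space ?P'" if "x \<in> space ?P" "y \<in> space \<mu>" for x y
    using that by (auto simp: space_PiM PiE_iff extensional_def)
  have meas2: "(\<lambda>p. f ((fst p)(i := snd p))) \<in> borel_measurable (?P \<Otimes>\<^sub>M \<mu>)"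
  proof -
    have "f \<circ> (\<lambda>(x, y). x(i := y)) \<in> borel_measurable (?P \<Otimes>\<^sub>M \<mu>)"
      by (rule measurable_comp[OF measurable_add_dim insert.prems(1)])
    then show ?thesis by (simp add: comp_def case_prod_unfold)
  qed
  have meas1: "(\<lambda>y. f (x(i := y))) \<in> borel_measurable \<mu>" if "x \<in> space ?P" for x
    using measurable_compose[OF measurable_Pair1'[OF that] meas2] by simp
  have int1: "integrable \<mu> (\<lambda>y. f (x(i := y)))" if "x \<in> space ?P" for x
    using upd[OF that] insert.prems(2) meas1[OF that]
    by (intro \<mu>.integrable_const_bound[of _ C]) auto
  define g where "g x = (\<integral>y. f (x(i := y)) \<partial>\<mu>)" for x
  have g_meas [measurable]: "g \<in> borel_measurable ?P"
    unfolding g_def using meas2 by (intro \<mu>.borel_measurable_lebesgue_integral) (simp add: case_prod_unfold)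
  have g_bound: "\<bar>g x\<bar> \<le> C" if "x \<in> space ?P" for x
  proof -
    have "norm (g x) \<le> (\<integral>y. norm (f (x(i := y))) \<partial>\<mu>)" unfolding g_def by simp
    also have "\<dots> \<le> (\<integral>y. C \<partial>\<mu>)"
      using int1[OF that] upd[OF that] insert.prems(2) by (intro integral_mono) auto
    finally show ?thesis by (simp add: \<mu>.prob_space)
  qed
  have g_diff: "\<bar>g (x(j := z)) - g x\<bar> \<le> c" if x: "x \<in> space ?P" and j: "j \<in> I" and z: "z \<in> space \<mu>" for x j z
  proof -
    have xz: "x(j := z) \<in> space ?P" using x j z by (auto simp: space_PiM PiE_iff extensional_def)
    have ji: "j \<noteq> i" using j insert.hyps by auto
    have "\<bar>f (x(j := z, i := y)) - f (x(i := y))\<bar> \<le> c" if y: "y \<in> space \<mu>" for y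
      unfolding fun_upd_twist[OF ji] by (rule insert.prems(3)[OF upd[OF x y] insertI2[OF j] z])
    then have "(\<integral>y. norm (f (x(j := z, i := y)) - f (x(i := y))) \<partial>\<mu>) \<le> (\<integral>y. c \<partial>\<mu>)"
      using int1[OF x] int1[OF xz] by (intro integral_mono) auto
    moreover have "g (x(j := z)) - g x = (\<integral>y. f (x(j := z, i := y)) - f (x(i := y)) \<partial>\<mu>)"
      unfolding g_def using int1[OF x] int1[OF xz] by simp
    then have "norm (g (x(j := z)) - g x) \<le> (\<integral>y. norm (f (x(j := z, i := y)) - f (x(i := y))) \<partial>\<mu>)"
      by simp
    ultimately show ?thesis by (simp add: \<mu>.prob_space)
  qed
  have "integrable ?P' f"
    using insert.prems(1,2) by (intro PI'.integrable_const_bound[of _ C]) auto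
  then have E: "integral\<^sup>L ?P' f = integral\<^sup>L ?P g"
    unfolding g_def by (rule product_integral_insert[OF insert.hyps])
  let ?e = "integral\<^sup>L ?P g"
  have inner: "(\<integral>\<^sup>+y. exp (l * (f (x(i := y)) - g x)) \<partial>\<mu>) \<le> exp (l\<^sup>2 * c\<^sup>2 / 2)" if x: "x \<in> space ?P" for x
  proof -
    \<comment> \<open>The values lie within \<open>c\<close> of the value at a reference point
      \<open>y0\<close>, hence in an interval of length \<open>2 * c\<close>; Hoeffding's exponent
      \<open>l\<^sup>2 * (2 * c)\<^sup>2 / 8\<close> is then
      \<open>l\<^sup>2 * c\<^sup>2 / 2\<close>.\<close>
    obtain y0 where y0: "y0 \<in> space \<mu>" using \<mu>.not_empty by blast
    have "f (x(i := y)) \<in> {f (x(i := y0)) - c..f (x(i := y0)) + c}" if "y \<in> space \<mu>" for y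
      using insert.prems(3)[OF upd[OF x y0] insertI1 that, unfolded fun_upd_upd]
      unfolding atLeastAtMost_iff by linarith
    then interpret interval_bounded_random_variable \<mu> "\<lambda>y. f (x(i := y))" "f (x(i := y0)) - c" "f (x(i := y0)) + c"
      using meas1[OF x] by unfold_locales auto
    show ?thesis
      using Hoeffdings_lemma_nn_integral[OF assms(4)] unfolding g_def by (simp add: power2_eq_square algebra_simps)
  qed
  have "(\<integral>\<^sup>+x. exp (l * (f x - integral\<^sup>L ?P' f)) \<partial>?P')
    = (\<integral>\<^sup>+x. (\<integral>\<^sup>+y. exp (l * (f (x(i := y)) - ?e)) \<partial>\<mu>) \<partial>?P)"
    unfolding E by (intro product_nn_integral_insert insert.hyps) measurable
  also have "\<dots> \<le> (\<integral>\<^sup>+x. ennreal (exp (l * (g x - ?e))) * exp (l\<^sup>2 * c\<^sup>2 / 2) \<partial>?P)"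
  proof (rule nn_integral_mono)
    fix x assume x: "x \<in> space ?P"
    note [measurable] = meas1[OF x]
    have "(\<integral>\<^sup>+y. exp (l * (f (x(i := y)) - ?e)) \<partial>\<mu>)
      = (\<integral>\<^sup>+y. ennreal (exp (l * (g x - ?e))) * exp (l * (f (x(i := y)) - g x)) \<partial>\<mu>)"
      by (intro nn_integral_cong) (simp add: ennreal_mult[symmetric] exp_add[symmetric] algebra_simps)
    also have "\<dots> = ennreal (exp (l * (g x - ?e))) * (\<integral>\<^sup>+y. exp (l * (f (x(i := y)) - g x)) \<partial>\<mu>)"
      by (rule nn_integral_cmult) measurable
    also have "\<dots> \<le> ennreal (exp (l * (g x - ?e))) * exp (l\<^sup>2 * c\<^sup>2 / 2)"
      by (intro mult_left_mono inner x) simp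
    finally show "(\<integral>\<^sup>+y. exp (l * (f (x(i := y)) - ?e)) \<partial>\<mu>)
      \<le> ennreal (exp (l * (g x - ?e))) * exp (l\<^sup>2 * c\<^sup>2 / 2)" .
  qed
  also have "\<dots> = (\<integral>\<^sup>+x. exp (l * (g x - ?e)) \<partial>?P) * exp (l\<^sup>2 * c\<^sup>2 / 2)"
    by (rule nn_integral_multc) measurable
  also have "\<dots> \<le> exp (l\<^sup>2 * c\<^sup>2 / 2 * card I) * ennreal (exp (l\<^sup>2 * c\<^sup>2 / 2))"
    by (intro mult_right_mono insert.IH g_meas g_bound g_diff) auto
  also have "\<dots> = exp (l\<^sup>2 * c\<^sup>2 / 2 * card (insert i I))"
    using insert.hyps by (simp add: ennreal_mult[symmetric] exp_add[symmetric] distrib_left add.commute)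
  finally show ?case .
qed

lemma McDiarmid_ge:
  fixes f :: "('i \<Rightarrow> 'a) \<Rightarrow> real" and c :: real
  assumes \<mu>: "prob_space \<mu>" and I: "finite I" "I \<noteq> {}" and f: "f \<in> borel_measurable (PiM I (\<lambda>_. \<mu>))"
    and "0 < t" "0 < c"
    and "\<And>x. x \<in> space (PiM I (\<lambda>_. \<mu>)) \<Longrightarrow> \<bar>f x\<bar> \<le> C"
    and "\<And>x i y. x \<in> space (PiM I (\<lambda>_. \<mu>)) \<Longrightarrow> i \<in> I \<Longrightarrow> y \<in> space \<mu> \<Longrightarrow> \<bar>f (x(i := y)) - f x\<bar> \<le> c"
  defines "P \<equiv> PiM I (\<lambda>_. \<mu>)"
  shows "measure P {x \<in> space P. t \<le> f x - integral\<^sup>L P f} \<le> exp (- t\<^sup>2 / (2 * card I * c\<^sup>2))"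
proof -
  interpret P: prob_space P unfolding P_def by (rule prob_space_PiM) (rule \<mu>)
  note [measurable] = f[folded P_def]
  have n: "0 < real (card I)" using I by (simp add: card_gt_0_iff)
  \<comment> \<open>This \<open>l\<close> minimizes the Chernoff exponent
    \<open>- l * t + l\<^sup>2 * c\<^sup>2 / 2 * card I\<close>.\<close>
  define l where "l = t / (card I * c\<^sup>2)"
  have l: "0 < l" using assms n by (simp add: l_def)
  have "emeasure P {x \<in> space P. t \<le> f x - integral\<^sup>L P f}
    \<le> exp (- l * t) * (\<integral>\<^sup>+x. exp (l * (f x - integral\<^sup>L P f)) \<partial>P)"
    using Chernoff_ineq_nn_integral_ge[of l "space P" P "\<lambda>x. f x - integral\<^sup>L P f" t] l
    by (simp cong: nn_integral_cong)
  also have "\<dots> \<le> exp (- l * t) * ennreal (exp (l\<^sup>2 * c\<^sup>2 / 2 * card I))"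
    unfolding P_def using assms l by (intro mult_left_mono McDiarmid_mgf) auto
  also have "\<dots> = exp (- l * t + l\<^sup>2 * c\<^sup>2 / 2 * card I)"
    by (simp add: ennreal_mult[symmetric] exp_add[symmetric])
  also have "- l * t + l\<^sup>2 * c\<^sup>2 / 2 * card I = - t\<^sup>2 / (2 * card I * c\<^sup>2)"
    using n assms(6) by (simp add: l_def power2_eq_square field_simps)
  finally show ?thesis
    by (subst (asm) P.emeasure_eq_measure) (simp add: ennreal_le_iff)
qed

lemma McDiarmid_abs:
  fixes f :: "('i \<Rightarrow> 'a) \<Rightarrow> real" and c :: real
  assumes \<mu>: "prob_space \<mu>" and I: "finite I" "I \<noteq> {}" and f: "f \<in> borel_measurable (PiM I (\<lambda>_. \<mu>))"
    and "0 < t" "0 < c"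
    and bd: "\<And>x. x \<in> space (PiM I (\<lambda>_. \<mu>)) \<Longrightarrow> \<bar>f x\<bar> \<le> C"
    and df: "\<And>x i y. x \<in> space (PiM I (\<lambda>_. \<mu>)) \<Longrightarrow> i \<in> I \<Longrightarrow> y \<in> space \<mu> \<Longrightarrow> \<bar>f (x(i := y)) - f x\<bar> \<le> c"
  defines "P \<equiv> PiM I (\<lambda>_. \<mu>)"
  shows "measure P {x \<in> space P. t \<le> \<bar>f x - integral\<^sup>L P f\<bar>} \<le> 2 * exp (- t\<^sup>2 / (2 * card I * c\<^sup>2))"
proof -
  interpret P: prob_space P unfolding P_def by (rule prob_space_PiM) (rule \<mu>)
  note [measurable] = f[folded P_def]
  have "measure P {x \<in> space P. t \<le> \<bar>f x - integral\<^sup>L P f\<bar>}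
    \<le> measure P ({x \<in> space P. t \<le> f x - integral\<^sup>L P f} \<union> {x \<in> space P. t \<le> - f x - integral\<^sup>L P (\<lambda>x. - f x)})"
    by (intro P.finite_measure_mono) (auto simp: abs_real_def split: if_splits)
  also have "\<dots> \<le> measure P {x \<in> space P. t \<le> f x - integral\<^sup>L P f}
    + measure P {x \<in> space P. t \<le> - f x - integral\<^sup>L P (\<lambda>x. - f x)}"
    by (intro measure_Un_le) measurable
  also have "\<dots> \<le> exp (- t\<^sup>2 / (2 * card I * c\<^sup>2)) + exp (- t\<^sup>2 / (2 * card I * c\<^sup>2))"
  proof (rule add_mono)
    show "measure P {x \<in> space P. t \<le> f x - integral\<^sup>L P f} \<le> exp (- t\<^sup>2 / (2 * card I * c\<^sup>2))"
      unfolding P_def using bd df by (intro McDiarmid_ge[where C = C] assms) auto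
    have "\<bar>- f (x(i := y)) - - f x\<bar> \<le> c"
      if "x \<in> space (PiM I (\<lambda>_. \<mu>))" "i \<in> I" "y \<in> space \<mu>" for x i y
      using df[OF that] by linarith
    then show "measure P {x \<in> space P. t \<le> - f x - integral\<^sup>L P (\<lambda>x. - f x)} \<le> exp (- t\<^sup>2 / (2 * card I * c\<^sup>2))"
      unfolding P_def using bd f by (intro McDiarmid_ge[where C = C] assms borel_measurable_uminus) auto
  qed
  finally show ?thesis by simp
qed

section \<open>Averaging over all labelings of the points\<close>

lemma sum_PiE_insert:
  fixes F :: "('i \<Rightarrow> 'q) \<Rightarrow> 'b::comm_monoid_add"
  assumes "i \<notin> I"
  shows "(\<Sum>\<sigma>\<in>PiE (insert i I) (\<lambda>_. Q). F \<sigma>) = (\<Sum>\<sigma>\<in>PiE I (\<lambda>_. Q). \<Sum>q\<in>Q. F (\<sigma>(i := q)))"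
proof -
  have "(\<Sum>\<sigma>\<in>PiE (insert i I) (\<lambda>_. Q). F \<sigma>) = (\<Sum>p\<in>Q \<times> PiE I (\<lambda>_. Q). F ((\<lambda>(q, \<sigma>). \<sigma>(i := q)) p))"
    unfolding PiE_insert_eq by (rule sum.reindex[OF inj_combinator[OF assms], unfolded comp_def])
  also have "\<dots> = (\<Sum>q\<in>Q. \<Sum>\<sigma>\<in>PiE I (\<lambda>_. Q). F (\<sigma>(i := q)))"
    by (simp add: sum.cartesian_product case_prod_unfold)
  also have "\<dots> = (\<Sum>\<sigma>\<in>PiE I (\<lambda>_. Q). \<Sum>q\<in>Q. F (\<sigma>(i := q)))" by (rule sum.swap)
  finally show ?thesis .
qed

text \<open>Mean and variance of a binomial count, multiplied by the number of labelings: under a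
  uniformly random labeling, label \<open>q\<close> is used \<open>card I * p\<close> times on
  average, with variance at most \<open>card I * p\<close>. When an index is added, the cross term
  vanishes because the deviations \<open>of_bool (r = q) - p\<close> sum to zero over
  \<open>r\<close>.\<close>

lemma labeling_variance:
  fixes q :: 'q and I :: "'i set" and p :: real
  assumes "finite Q" "q \<in> Q" "finite I"
  defines "p \<equiv> 1 / real (card Q)"
  shows "(\<Sum>\<sigma>\<in>PiE I (\<lambda>_. Q). (\<Sum>i\<in>I. of_bool (\<sigma> i = q) - p)) = 0 \<and>
    (\<Sum>\<sigma>\<in>PiE I (\<lambda>_. Q). (\<Sum>i\<in>I. of_bool (\<sigma> i = q) - p)\<^sup>2) \<le> real (card Q) ^ card I * (card I * p)"
  using assms(3)
proof (induction I rule: finite_induct)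
  case (insert i I)
  let ?S = "\<lambda>\<sigma>. \<Sum>i\<in>I. of_bool (\<sigma> i = q) - p"
  have N: "0 < real (card Q)" using assms(1,2) by (auto simp: card_gt_0_iff)
  have S: "(\<Sum>j\<in>insert i I. of_bool ((\<sigma>(i := r)) j = q) - p) = ?S \<sigma> + (of_bool (r = q) - p)" for \<sigma> r
  proof -
    have "(\<Sum>j\<in>I. of_bool ((\<sigma>(i := r)) j = q) - p) = ?S \<sigma>"
      using insert.hyps by (intro sum.cong) auto
    then show ?thesis using insert.hyps by simp
  qed
  have b: "(\<Sum>r\<in>Q. of_bool (r = q)) = (1::real)" using assms(1,2) by (simp add: sum.delta' of_bool_def)
  have s1: "(\<Sum>r\<in>Q. of_bool (r = q) - p) = 0" using b N by (simp add: sum_subtractf p_def)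
  have "(of_bool (r = q) - p)\<^sup>2 = of_bool (r = q) * (1 - 2 * p) + p\<^sup>2" for r
    by (auto simp: power2_eq_square algebra_simps)
  then have "(\<Sum>r\<in>Q. (of_bool (r = q) - p)\<^sup>2) = (\<Sum>r\<in>Q. of_bool (r = q)) * (1 - 2 * p) + card Q * p\<^sup>2"
    by (simp add: sum.distrib sum_distrib_right)
  also have "\<dots> = 1 - p" using N by (simp add: b) (simp add: p_def power2_eq_square field_simps)
  finally have s2: "(\<Sum>r\<in>Q. (of_bool (r = q) - p)\<^sup>2) \<le> 1" using N by (simp add: p_def)
  have "(\<Sum>r\<in>Q. ?S \<sigma> + (of_bool (r = q) - p)) = card Q * ?S \<sigma>" for \<sigma>
    using s1 by (simp add: sum.distrib)
  then have 1: "(\<Sum>\<sigma>\<in>PiE (insert i I) (\<lambda>_. Q). (\<Sum>j\<in>insert i I. of_bool (\<sigma> j = q) - p)) = 0"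
    unfolding sum_PiE_insert[OF insert.hyps(2)] S using insert.IH by (simp add: sum_distrib_left[symmetric])
  have "(\<Sum>r\<in>Q. (?S \<sigma> + (of_bool (r = q) - p))\<^sup>2) \<le> card Q * (?S \<sigma>)\<^sup>2 + 1" for \<sigma>
  proof -
    have "(\<Sum>r\<in>Q. (?S \<sigma> + (of_bool (r = q) - p))\<^sup>2)
      = (\<Sum>r\<in>Q. (?S \<sigma>)\<^sup>2 + 2 * ?S \<sigma> * (of_bool (r = q) - p) + (of_bool (r = q) - p)\<^sup>2)"
    proof -
      have "(a + b)\<^sup>2 = a\<^sup>2 + 2 * a * b + b\<^sup>2" for a b :: real by (simp add: power2_sum)
      then show ?thesis by (simp only:)
    qed
    also have "\<dots> = card Q * (?S \<sigma>)\<^sup>2 + 2 * ?S \<sigma> * (\<Sum>r\<in>Q. of_bool (r = q) - p) + (\<Sum>r\<in>Q. (of_bool (r = q) - p)\<^sup>2)"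
      by (simp only: sum.distrib sum_distrib_left[symmetric] sum_constant)
    finally show ?thesis using s1 s2 by simp
  qed
  then have "(\<Sum>\<sigma>\<in>PiE (insert i I) (\<lambda>_. Q). (\<Sum>j\<in>insert i I. of_bool (\<sigma> j = q) - p)\<^sup>2)
    \<le> (\<Sum>\<sigma>\<in>PiE I (\<lambda>_. Q). card Q * (?S \<sigma>)\<^sup>2 + 1)"
    unfolding sum_PiE_insert[OF insert.hyps(2)] S by (intro sum_mono)
  also have "\<dots> = card Q * (\<Sum>\<sigma>\<in>PiE I (\<lambda>_. Q). (?S \<sigma>)\<^sup>2) + real (card Q) ^ card I"
    using insert.hyps(1) by (simp add: sum.distrib sum_distrib_left card_PiE)
  also have "\<dots> \<le> card Q * (real (card Q) ^ card I * (card I * p)) + real (card Q) ^ card I"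
    using insert.IH by (intro add_right_mono mult_left_mono) auto
  also have "\<dots> = real (card Q) ^ card (insert i I) * (card (insert i I) * p)"
    using insert.hyps N by (simp add: p_def field_simps)
  finally show ?case using 1 by simp
qed simp

text \<open>Multiplying out a product of mixtures: each coordinate chooses its component \<sigma> i
  separately. Domination instead of equality is enough for upper bounds on means, and it makes
  overlaps of the components irrelevant.\<close>

lemma nn_integral_PiM_mixture:
  fixes w :: ennreal and \<phi> :: "'q \<Rightarrow> 'a \<Rightarrow> 'a" and I :: "'i set" and h :: "('i \<Rightarrow> 'a) \<Rightarrow> ennreal"
  assumes \<mu>: "prob_space \<mu>" and "finite I" and \<phi>: "\<And>q. q \<in> Q \<Longrightarrow> \<phi> q \<in> measurable \<mu> \<mu>"
    and mix: "\<And>h. h \<in> borel_measurable \<mu> \<Longrightarrow> (\<integral>\<^sup>+y. h y \<partial>\<mu>) \<le> w * (\<Sum>q\<in>Q. \<integral>\<^sup>+y. h (\<phi> q y) \<partial>\<mu>)"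
    and "h \<in> borel_measurable (PiM I (\<lambda>_. \<mu>))"
  shows "(\<integral>\<^sup>+x. h x \<partial>PiM I (\<lambda>_. \<mu>))
    \<le> w ^ card I * (\<Sum>\<sigma>\<in>PiE I (\<lambda>_. Q). \<integral>\<^sup>+x. h (\<lambda>i\<in>I. \<phi> (\<sigma> i) (x i)) \<partial>PiM I (\<lambda>_. \<mu>))"
  using assms(2,5)
proof (induction I arbitrary: h rule: finite_induct)
  case empty
  show ?case by (simp add: PiM_empty nn_integral_count_space_finite restrict_def)
next
  case (insert i I h)
  interpret \<mu>: prob_space \<mu> by (rule \<mu>)
  interpret product_sigma_finite "\<lambda>_::'i. \<mu>" by unfold_locales
  let ?P = "PiM I (\<lambda>_. \<mu>)" and ?P' = "PiM (insert i I) (\<lambda>_. \<mu>)"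
  interpret PI: prob_space ?P by (rule prob_space_PiM) (rule \<mu>)
  note [measurable] = insert.prems
  have meas2: "(\<lambda>p. h ((fst p)(i := snd p))) \<in> borel_measurable (?P \<Otimes>\<^sub>M \<mu>)"
  proof -
    have "h \<circ> (\<lambda>(x, y). x(i := y)) \<in> borel_measurable (?P \<Otimes>\<^sub>M \<mu>)"
      by (rule measurable_comp[OF measurable_add_dim insert.prems(1)])
    then show ?thesis by (simp add: comp_def case_prod_unfold)
  qed
  have meas1: "(\<lambda>y. h (x(i := y))) \<in> borel_measurable \<mu>" if "x \<in> space ?P" for x
    using measurable_compose[OF measurable_Pair1'[OF that] meas2] by simp
  define H where "H x = (\<integral>\<^sup>+y. h (x(i := y)) \<partial>\<mu>)" for x
  have H_meas: "H \<in> borel_measurable ?P"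
    unfolding H_def using meas2 by (intro \<mu>.borel_measurable_nn_integral) (simp add: case_prod_unfold)
  have lab_meas: "(\<lambda>x. \<lambda>j\<in>J. \<phi> (\<sigma> j) (x j)) \<in> measurable (PiM J (\<lambda>_. \<mu>)) (PiM J (\<lambda>_. \<mu>))"
    if "\<sigma> \<in> PiE J (\<lambda>_. Q)" for J and \<sigma> :: "'i \<Rightarrow> 'q"
  proof (rule measurable_restrict)
    fix j assume j: "j \<in> J"
    then have "\<phi> (\<sigma> j) \<in> measurable \<mu> \<mu>" using that by (intro \<phi>) auto
    with measurable_component_singleton[OF j]
    show "(\<lambda>x. \<phi> (\<sigma> j) (x j)) \<in> measurable (PiM J (\<lambda>_. \<mu>)) \<mu>"
      by (rule measurable_compose)
  qed
  \<comment> \<open>With the coordinates in \<open>I\<close> already transformed according to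
    \<sigma>, the hypothesis \<open>mix\<close> is applied to coordinate \<open>i\<close> alone; the
    choice of \<open>q\<close> extends \<sigma> to \<open>insert i I\<close>.\<close>
  have step: "(\<integral>\<^sup>+x. H (\<lambda>j\<in>I. \<phi> (\<sigma> j) (x j)) \<partial>?P)
    \<le> w * (\<Sum>q\<in>Q. \<integral>\<^sup>+x. h (\<lambda>j\<in>insert i I. \<phi> ((\<sigma>(i := q)) j) (x j)) \<partial>?P')"
    if \<sigma>: "\<sigma> \<in> PiE I (\<lambda>_. Q)" for \<sigma>
  proof -
    let ?r = "\<lambda>x. \<lambda>j\<in>I. \<phi> (\<sigma> j) (x j)"
    have r: "?r x \<in> space ?P" if "x \<in> space ?P" for x
      using measurable_space[OF lab_meas[OF \<sigma>] that] .
    have m: "(\<lambda>x. \<integral>\<^sup>+y. h ((?r x)(i := \<phi> q y)) \<partial>\<mu>) \<in> borel_measurable ?P" if "q \<in> Q" for q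
    proof -
      have "(\<lambda>p. (?r (fst p), \<phi> q (snd p))) \<in> measurable (?P \<Otimes>\<^sub>M \<mu>) (?P \<Otimes>\<^sub>M \<mu>)"
        by (intro measurable_Pair measurable_compose[OF measurable_fst lab_meas[OF \<sigma>]]
            measurable_compose[OF measurable_snd \<phi>[OF that]])
      from measurable_compose[OF this meas2] show ?thesis
        by (intro \<mu>.borel_measurable_nn_integral) (simp add: case_prod_unfold)
    qed
    have "(\<integral>\<^sup>+x. H (?r x) \<partial>?P) \<le> (\<integral>\<^sup>+x. w * (\<Sum>q\<in>Q. \<integral>\<^sup>+y. h ((?r x)(i := \<phi> q y)) \<partial>\<mu>) \<partial>?P)"
      unfolding H_def by (intro nn_integral_mono mix meas1 r)
    also have "\<dots> = w * (\<Sum>q\<in>Q. \<integral>\<^sup>+x. \<integral>\<^sup>+y. h ((?r x)(i := \<phi> q y)) \<partial>\<mu> \<partial>?P)"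
      using m by (subst nn_integral_cmult) (auto simp: nn_integral_sum)
    also have "(\<Sum>q\<in>Q. \<integral>\<^sup>+x. \<integral>\<^sup>+y. h ((?r x)(i := \<phi> q y)) \<partial>\<mu> \<partial>?P)
      = (\<Sum>q\<in>Q. \<integral>\<^sup>+x. h (\<lambda>j\<in>insert i I. \<phi> ((\<sigma>(i := q)) j) (x j)) \<partial>?P')"
    proof (rule sum.cong[OF refl])
      fix q assume q: "q \<in> Q"
      have \<sigma>': "\<sigma>(i := q) \<in> PiE (insert i I) (\<lambda>_. Q)" using \<sigma> q by (rule PiE_fun_upd[rotated])
      have "(\<integral>\<^sup>+x. h (\<lambda>j\<in>insert i I. \<phi> ((\<sigma>(i := q)) j) (x j)) \<partial>?P')
        = (\<integral>\<^sup>+x. \<integral>\<^sup>+y. h (\<lambda>j\<in>insert i I. \<phi> ((\<sigma>(i := q)) j) ((x(i := y)) j)) \<partial>\<mu> \<partial>?P)"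
        by (intro product_nn_integral_insert insert.hyps measurable_compose[OF lab_meas[OF \<sigma>'] insert.prems])
      also have "\<dots> = (\<integral>\<^sup>+x. \<integral>\<^sup>+y. h ((?r x)(i := \<phi> q y)) \<partial>\<mu> \<partial>?P)"
        using insert.hyps(2) by (intro nn_integral_cong arg_cong[where f = h]) (auto simp: fun_eq_iff)
      finally show "(\<integral>\<^sup>+x. \<integral>\<^sup>+y. h ((?r x)(i := \<phi> q y)) \<partial>\<mu> \<partial>?P)
        = (\<integral>\<^sup>+x. h (\<lambda>j\<in>insert i I. \<phi> ((\<sigma>(i := q)) j) (x j)) \<partial>?P')" by simp
    qed
    finally show ?thesis .
  qed
  have "(\<integral>\<^sup>+x. h x \<partial>?P') = (\<integral>\<^sup>+x. H x \<partial>?P)"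
    unfolding H_def by (intro product_nn_integral_insert insert)
  also have "\<dots> \<le> w ^ card I * (\<Sum>\<sigma>\<in>PiE I (\<lambda>_. Q). \<integral>\<^sup>+x. H (\<lambda>j\<in>I. \<phi> (\<sigma> j) (x j)) \<partial>?P)"
    by (rule insert.IH[OF H_meas])
  also have "\<dots> \<le> w ^ card I * (\<Sum>\<sigma>\<in>PiE I (\<lambda>_. Q). w * (\<Sum>q\<in>Q. \<integral>\<^sup>+x. h (\<lambda>j\<in>insert i I. \<phi> ((\<sigma>(i := q)) j) (x j)) \<partial>?P'))"
    by (intro mult_left_mono sum_mono step) auto
  also have "\<dots> = w ^ card (insert i I) * (\<Sum>\<sigma>\<in>PiE (insert i I) (\<lambda>_. Q). \<integral>\<^sup>+x. h (\<lambda>j\<in>insert i I. \<phi> (\<sigma> j) (x j)) \<partial>?P')"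
    unfolding sum_PiE_insert[OF insert.hyps(2)] card_insert_disjoint[OF insert.hyps(1,2)] power_Suc
    by (simp only: sum_distrib_left[symmetric] mult.assoc mult.left_commute[of w])
  finally show ?case .
qed

section \<open>A limit theorem for quasi-subadditive sequences\<close>

text \<open>The limit is the infimum of the bounds on the limit superior that \<open>grid\<close> provides for each \<open>l\<close>.\<close>

lemma quasi_subadditive_limit:
  fixes a :: "nat \<Rightarrow> real"
  assumes nonneg: "\<And>n. 0 \<le> a n"
    and smooth: "\<And>n k. k \<le> n \<Longrightarrow> a n \<le> a k + L * sqrt (n - k)"
    and grid: "\<And>m l. 1 \<le> m \<Longrightarrow> 1 \<le> l \<Longrightarrow> a (m\<^sup>2 * l) \<le> m * (a l + C * sqrt (sqrt l))"
    and "0 \<le> C" "0 \<le> L"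
  shows "\<exists>\<beta>. (\<lambda>n. a n / sqrt n) \<longlonglongrightarrow> \<beta>"
proof -
  \<comment> \<open>This is the bound of \<open>grid\<close> divided by
    \<open>sqrt (m\<^sup>2 * l) = m * sqrt l\<close>; the factor \<open>m\<close> cancels.\<close>
  define b where "b l = a l / sqrt l + C / sqrt (sqrt l)" for l :: nat
  have b0: "0 \<le> b l" for l using nonneg assms(4) by (simp add: b_def)
  define \<beta> where "\<beta> = Inf (b ` {1..})"
  have low: "\<beta> \<le> b n" if "1 \<le> n" for n
    unfolding \<beta>_def using that b0 by (intro cInf_lower bdd_belowI2[of _ 0]) auto
  have up: "\<forall>\<^sub>F n in sequentially. a n / sqrt n \<le> b l + e" if l: "1 \<le> l" and e: "0 < e" for l e
  proof -
    have lim: "filterlim (\<lambda>n. nat \<lfloor>sqrt (n / l)\<rfloor>) at_top sequentially"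
      using l by real_asymp
    have "filterlim (\<lambda>n. L * sqrt 3 / sqrt (nat \<lfloor>sqrt (n / l)\<rfloor>)) (nhds 0) sequentially"
    proof (rule filterlim_compose[OF _ lim])
      show "((\<lambda>m. L * sqrt 3 / sqrt (real m)) \<longlongrightarrow> 0) at_top" by real_asymp
    qed
    then have "\<forall>\<^sub>F n in sequentially. L * sqrt 3 / sqrt (nat \<lfloor>sqrt (n / l)\<rfloor>) < e"
      using e by (rule order_tendstoD)
    moreover have "\<forall>\<^sub>F n in sequentially. 1 \<le> nat \<lfloor>sqrt (n / l)\<rfloor>"
      using lim by (simp add: filterlim_at_top)
    ultimately show ?thesis
    proof eventually_elim
      case (elim n)
      \<comment> \<open>The largest \<open>m\<close> with \<open>m\<^sup>2 * l \<le> n\<close>. The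
        gap \<open>n - m\<^sup>2 * l\<close> is at most \<open>3 * m * l\<close>, so smoothness
        costs a multiple of \<open>sqrt m\<close>, negligible against \<open>m * sqrt l\<close> for
        fixed \<open>l\<close>.\<close>
      define m where "m = nat \<lfloor>sqrt (n / l)\<rfloor>"
      have m: "1 \<le> m" "L * sqrt 3 / sqrt m < e" using elim by (simp_all add: m_def)
      have ml: "real m \<le> sqrt (n / l)" "sqrt (n / l) \<le> real m + 1"
        unfolding m_def by (rule of_nat_floor, simp) linarith
      then have "(real m)\<^sup>2 \<le> (sqrt (n / l))\<^sup>2" "(sqrt (n / l))\<^sup>2 \<le> (real m + 1)\<^sup>2"
        by (intro power_mono; simp)+
      then have "(real m)\<^sup>2 \<le> n / l" "n / l \<le> (real m + 1)\<^sup>2" by simp_all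
      then have ml2: "(real m)\<^sup>2 * l \<le> n" "n \<le> (real m + 1)\<^sup>2 * l" using l by (simp_all add: field_simps)
      then have le: "m\<^sup>2 * l \<le> n" by (metis of_nat_le_iff of_nat_mult of_nat_power)
      have "real n - real (m\<^sup>2 * l) \<le> (2 * real m + 1) * l"
        using ml2(2) by (simp add: power2_eq_square algebra_simps)
      also have "\<dots> \<le> 3 * (real m * l)" using mult_right_mono[of 1 "real m" "real l"] m(1) by (simp add: algebra_simps)
      finally have gap: "sqrt (real n - real (m\<^sup>2 * l)) \<le> sqrt (3 * (real m * l))" by simp
      have A: "a n \<le> m * (a l + C * sqrt (sqrt l)) + L * sqrt (3 * (real m * l))"
        using smooth[OF le] grid[OF m(1) l] mult_left_mono[OF gap assms(5)] by linarith
      have ge: "m * sqrt l \<le> sqrt n"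
        using ml2(1) by (intro real_le_rsqrt) (simp add: power_mult_distrib)
      have pos: "0 < m * sqrt l" using m(1) l by simp
      have "a n / sqrt n \<le> (m * (a l + C * sqrt (sqrt l)) + L * sqrt (3 * (real m * l))) / (m * sqrt l)"
      proof (rule frac_le)
        show "0 \<le> m * (a l + C * sqrt (sqrt l)) + L * sqrt (3 * (real m * l))"
          using nonneg[of n] A by linarith
      qed (use A ge pos in auto)
      also have "\<dots> = (a l + C * sqrt (sqrt l)) / sqrt l + L * sqrt 3 / sqrt m"
      proof -
        define s where "s = sqrt (real m)"
        have s: "real m = s * s" "0 < s" using m(1) by (simp_all add: s_def)
        have "sqrt (3 * (real m * l)) = sqrt 3 * (s * sqrt l)" by (simp add: real_sqrt_mult s_def)
        then show ?thesis using s(2) l unfolding s_def[symmetric] s(1) by (simp add: field_simps)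
      qed
      also have "(a l + C * sqrt (sqrt l)) / sqrt l = b l"
      proof -
        define s where "s = sqrt (sqrt (real l))"
        have s: "sqrt (real l) = s * s" "0 < s" using l by (simp_all add: s_def)
        show ?thesis using s(2) unfolding b_def s_def[symmetric] s(1) by (simp add: field_simps)
      qed
      finally show ?case using m(2) by simp
    qed
  qed
  have "(\<lambda>n. a n / sqrt n) \<longlonglongrightarrow> \<beta>"
  proof (rule order_tendstoI)
    fix y assume y: "y < \<beta>"
    \<comment> \<open>For the lower bound, \<beta> \<le> \<open>b n\<close> already holds at
      \<open>n\<close> itself, and the second summand of \<open>b n\<close> vanishes in the
      limit.\<close>
    have "((\<lambda>n. C / sqrt (sqrt (real n))) \<longlongrightarrow> 0) sequentially" by real_asymp
    then have "\<forall>\<^sub>F n in sequentially. C / sqrt (sqrt (real n)) < \<beta> - y"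
      using y by (intro order_tendstoD) auto
    then show "\<forall>\<^sub>F n in sequentially. y < a n / sqrt n"
      using eventually_ge_at_top[of 1] by eventually_elim (use low in \<open>fastforce simp: b_def\<close>)
  next
    fix y assume y: "\<beta> < y"
    obtain l where l: "1 \<le> l" "b l < (\<beta> + y) / 2"
    proof -
      have "\<exists>z \<in> b ` {1..}. z < (\<beta> + y) / 2"
        unfolding \<beta>_def using y b0
        by (subst cInf_less_iff[symmetric]) (auto simp: \<beta>_def intro!: bdd_belowI2[of _ 0])
      then show ?thesis using that by auto
    qed
    have "b l + (y - \<beta>) / 2 < (\<beta> + y) / 2 + (y - \<beta>) / 2" using l(2) by simp
    also have "\<dots> = y" by (simp add: field_simps)
    finally have less: "b l + (y - \<beta>) / 2 < y" .
    have "\<forall>\<^sub>F n in sequentially. a n / sqrt n \<le> b l + (y - \<beta>) / 2" using y l by (intro up) auto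
    then show "\<forall>\<^sub>F n in sequentially. a n / sqrt n < y"
      by eventually_elim (rule le_less_trans[OF _ less])
  qed
  then show ?thesis by blast
qed

section \<open>Uniform points in the unit square\<close>

abbreviation unit_square_measure :: "(real^2) measure" where
  "unit_square_measure \<equiv> uniform_measure lborel (cbox 0 1)"

lemma emeasure_unit_square: "emeasure lborel (cbox 0 (1 :: real^2)) = 1"
proof -
  have "cbox 0 (1 :: real^2) \<noteq> {}" by (auto simp: interval_ne_empty_cart)
  then have "measure lborel (cbox 0 (1 :: real^2)) = 1" by (simp add: content_cbox_cart)
  moreover have "emeasure lborel (cbox 0 (1 :: real^2)) = ennreal (measure lborel (cbox 0 (1 :: real^2)))"
    using emeasure_lborel_cbox_finite[of 0 "1 :: real^2"]
    by (intro emeasure_eq_ennreal_measure) (simp add: less_top)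
  ultimately show ?thesis by simp
qed

lemma prob_space_unit_square: "prob_space unit_square_measure"
  by (rule prob_space_uniform_measure) (simp_all add: emeasure_unit_square)

lemma sets_unit_square [simp, measurable_cong]: "sets unit_square_measure = sets borel"
  and space_unit_square [simp]: "space unit_square_measure = UNIV"
  by simp_all

text \<open>Clamping makes the bounds for points of the square hold everywhere instead of almost everywhere.\<close>

definition clamp_square :: "real^2 \<Rightarrow> real^2" where
  "clamp_square = clamp 0 1"

lemma clamp_square_mem: "clamp_square v \<in> cbox 0 1"
  unfolding clamp_square_def by (rule clamp_in_interval) (auto simp: Basis_vec_def inner_axis)

lemma clamp_square_eq: "v \<in> cbox 0 1 \<Longrightarrow> clamp_square v = v"
  unfolding clamp_square_def by simp

lemma clamp_square_measurable [measurable]: "clamp_square \<in> borel_measurable borel"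
proof -
  have "continuous_on UNIV (\<lambda>v. (\<lambda>w. w) (clamp 0 (1 :: real^2) v))"
    by (rule clamp_continuous_on) (rule continuous_on_id)
  then show ?thesis unfolding clamp_square_def by (intro borel_measurable_continuous_onI) simp
qed

definition corner :: "nat \<Rightarrow> nat \<times> nat \<Rightarrow> real^2" where
  "corner m q = (\<chi> k. (if k = 1 then real (fst q) else real (snd q)) / real m)"

text \<open>The similarity from the unit square onto grid cell \<open>q\<close>. Clamping first
  keeps the image inside the cell for every \<open>v\<close>.\<close>

definition place :: "nat \<Rightarrow> nat \<times> nat \<Rightarrow> real^2 \<Rightarrow> real^2" where
  "place m q v = (1 / real m) *\<^sub>R clamp_square v + corner m q"

abbreviation cells :: "nat \<Rightarrow> (nat \<times> nat) set" where
  "cells m \<equiv> {..<m} \<times> {..<m}"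

lemma place_measurable [measurable]: "place m q \<in> borel_measurable borel"
  unfolding place_def by measurable

lemma place_mem:
  assumes "1 \<le> m" "q \<in> cells m"
  shows "place m q v \<in> cbox 0 1"
proof -
  have "0 \<le> place m q v $ k \<and> place m q v $ k \<le> 1" for k
  proof -
    have c: "0 \<le> clamp_square v $ k" "clamp_square v $ k \<le> 1"
      using clamp_square_mem[of v] by (auto simp: mem_box_cart)
    define z where "z = (if k = 1 then fst q else snd q)"
    have "z < m" using assms by (auto simp: z_def)
    then have "real z + 1 \<le> real m" by linarith
    moreover have "place m q v $ k = (clamp_square v $ k + real z) / real m"
      using assms(1) by (simp add: place_def corner_def z_def add_divide_distrib)
    ultimately show ?thesis using c assms(1) by (simp add: divide_le_eq)
  qed
  then show ?thesis by (auto simp: mem_box_cart)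
qed

text \<open>The uniform law is the average of its copies on the \<open>m\<^sup>2\<close> cells, by
  an affine change of variables with Jacobian \<open>1 / m\<^sup>2\<close>. The closed cells cover
  the square but overlap on their edges, so the covering argument yields an inequality.\<close>

lemma unit_square_mixture:
  fixes h :: "real^2 \<Rightarrow> ennreal"
  assumes m: "1 \<le> m" and [measurable]: "h \<in> borel_measurable borel"
  shows "(\<integral>\<^sup>+x. h x \<partial>unit_square_measure)
    \<le> ennreal (1 / (real m)\<^sup>2) * (\<Sum>q\<in>cells m. \<integral>\<^sup>+x. h (place m q x) \<partial>unit_square_measure)"
proof -
  have uni: "(\<integral>\<^sup>+x. f x \<partial>unit_square_measure) = (\<integral>\<^sup>+x. f x * indicator (cbox 0 1) x \<partial>lborel)"
    if "f \<in> borel_measurable borel" for f :: "real^2 \<Rightarrow> ennreal"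
    using that by (subst nn_integral_uniform_measure) (auto simp: emeasure_unit_square divide_ennreal_def)
  define Q where "Q q = {x. real m *\<^sub>R (x - corner m q) \<in> cbox 0 (1 :: real^2)}" for q
  have Q_sets [measurable]: "Q q \<in> sets borel" for q
  proof -
    have "(\<lambda>x. real m *\<^sub>R (x - corner m q)) -` cbox 0 (1 :: real^2) \<inter> space borel \<in> sets borel"
      by (intro measurable_sets[of _ borel borel]) auto
    then show ?thesis by (simp add: Q_def vimage_def)
  qed
  have cover: "\<exists>q\<in>cells m. x \<in> Q q" if x: "x \<in> cbox 0 1" for x
  proof -
    have bd: "0 \<le> x $ k" "x $ k \<le> 1" for k using x by (auto simp: mem_box_cart)
    let ?q = "(cell m (x $ 1), cell m (x $ 2))"
    have "0 \<le> (real m *\<^sub>R (x - corner m ?q)) $ k \<and> (real m *\<^sub>R (x - corner m ?q)) $ k \<le> 1" for k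
    proof -
      have "corner m ?q $ k = real (cell m (x $ k)) / m"
        using exhaust_2[of k] by (auto simp: corner_def)
      then show ?thesis
        using cell_bounds(2,3)[OF m bd[of k]] m by (simp add: field_simps)
    qed
    then have "x \<in> Q ?q" by (auto simp: Q_def mem_box_cart)
    then show ?thesis using cell_bounds(1)[OF m] bd by (intro bexI[of _ ?q]) auto
  qed
  have "(\<integral>\<^sup>+x. h x \<partial>unit_square_measure) = (\<integral>\<^sup>+x. h x * indicator (cbox 0 1) x \<partial>lborel)"
    by (rule uni) measurable
  also have "\<dots> \<le> (\<integral>\<^sup>+x. (\<Sum>q\<in>cells m. h x * indicator (Q q) x) \<partial>lborel)"
  proof (rule nn_integral_mono)
    fix x :: "real^2"
    show "h x * indicator (cbox 0 1) x \<le> (\<Sum>q\<in>cells m. h x * indicator (Q q) x)"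
    proof (cases "x \<in> cbox 0 1")
      case True
      then obtain q where q: "q \<in> cells m" "x \<in> Q q" using cover by blast
      have "h x * indicator (cbox 0 1) x = h x * indicator (Q q) x" using True q by simp
      also have "\<dots> \<le> (\<Sum>q\<in>cells m. h x * indicator (Q q) x)"
        using q(1) by (intro member_le_sum) auto
      finally show ?thesis .
    qed simp
  qed
  also have "\<dots> = (\<Sum>q\<in>cells m. \<integral>\<^sup>+x. h x * indicator (Q q) x \<partial>lborel)"
    by (rule nn_integral_sum) measurable
  also have "\<dots> = (\<Sum>q\<in>cells m. ennreal (1 / (real m)\<^sup>2) * (\<integral>\<^sup>+x. h (place m q x) \<partial>unit_square_measure))"
  proof (rule sum.cong[OF refl])
    fix q
    let ?t = "\<lambda>x. corner m q + (1 / real m) *\<^sub>R x"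
    have ind: "h (?t u) * indicator (Q q) (?t u) = h (place m q u) * indicator (cbox 0 1) u" for u
    proof -
      have "real m *\<^sub>R (?t u - corner m q) = u" using m by simp
      then have "?t u \<in> Q q \<longleftrightarrow> u \<in> cbox 0 1" by (simp add: Q_def)
      then show ?thesis
        using clamp_square_eq[of u] by (auto simp: indicator_def place_def add.commute)
    qed
    have "(\<integral>\<^sup>+x. h x * indicator (Q q) x \<partial>lborel)
      = (\<integral>\<^sup>+x. h x * indicator (Q q) x \<partial>density (distr lborel borel ?t) (\<lambda>_. ennreal (\<bar>1 / real m\<bar> ^ DIM(real^2))))"
      using m by (subst lborel_affine[of "1 / real m" "corner m q"]) auto
    also have "\<dots> = (\<integral>\<^sup>+u. ennreal (1 / (real m)\<^sup>2) * (h (?t u) * indicator (Q q) (?t u)) \<partial>lborel)"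
      by (simp add: nn_integral_density nn_integral_distr power_divide)
    also have "\<dots> = ennreal (1 / (real m)\<^sup>2) * (\<integral>\<^sup>+u. h (place m q u) * indicator (cbox 0 1) u \<partial>lborel)"
      unfolding ind by (rule nn_integral_cmult) measurable
    also have "(\<integral>\<^sup>+u. h (place m q u) * indicator (cbox 0 1) u \<partial>lborel) = (\<integral>\<^sup>+u. h (place m q u) \<partial>unit_square_measure)"
      by (rule uni[symmetric]) measurable
    finally show "(\<integral>\<^sup>+x. h x * indicator (Q q) x \<partial>lborel)
      = ennreal (1 / (real m)\<^sup>2) * (\<integral>\<^sup>+x. h (place m q x) \<partial>unit_square_measure)" .
  qed
  finally show ?thesis by (simp add: sum_distrib_left)
qed

section \<open>Measurability and the cost of clamped points\<close>

context truck_drone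
begin

text \<open>Both norms are \<open>B\<close>-Lipschitz for the Euclidean distance; for
  \<open>D\<close> this goes through \<open>D_le_T\<close>.\<close>

lemma T_D_measurable [measurable]: "T \<in> borel_measurable borel" "D \<in> borel_measurable borel"
proof -
  have T_norm: "T v \<le> B * norm v" for v
    by (rule T_le) (simp add: component_le_norm_cart)
  have D_minus: "D (- v) = D v" for v using D_scale[of "-1" v] by simp
  have T': "\<bar>T v - T w\<bar> \<le> B * norm (v - w)" for v w
    using T_add[of "v - w" w] T_add[of "w - v" v] T_commute[of v w] T_norm[of "v - w"] by simp
  have D': "\<bar>D v - D w\<bar> \<le> B * norm (v - w)" for v w
    using D_add[of "v - w" w] D_add[of "w - v" v] D_minus[of "v - w"] D_le_T[of "v - w"] T_norm[of "v - w"]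
    by simp
  have "B-lipschitz_on UNIV T" "B-lipschitz_on UNIV D"
    using T' D' B_pos by (auto simp: lipschitz_on_def dist_norm)
  then show "T \<in> borel_measurable borel" "D \<in> borel_measurable borel"
    using lipschitz_on_continuous_on borel_measurable_continuous_onI by blast+
qed

lemma path_length_measurable:
  fixes y :: "'w \<Rightarrow> 'i \<Rightarrow> real^2"
  assumes N: "N \<in> borel_measurable borel"
    and "\<And>i. i \<in> set is \<Longrightarrow> (\<lambda>w. y w i) \<in> borel_measurable M"
  shows "(\<lambda>w. path_length N (map (y w) is)) \<in> borel_measurable (M :: 'w measure)"
  using assms(2)
proof (induction "is" rule: induct_list012)
  case (3 i j "is")
  have [measurable]: "(\<lambda>w. y w i) \<in> borel_measurable M" "(\<lambda>w. y w j) \<in> borel_measurable M"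
    using 3 by auto
  have "(\<lambda>w. N (y w j - y w i)) \<in> borel_measurable M"
    by (rule measurable_compose[OF _ N]) measurable
  then show ?case using 3 by auto
qed auto

lemma plan_cost_measurable:
  assumes "\<And>i. i \<in> set (plan_nodes g) \<union> set es \<Longrightarrow> (\<lambda>w. y w i) \<in> borel_measurable M"
  shows "(\<lambda>w. plan_cost (y w) es g) \<in> borel_measurable (M :: 'w measure)"
  using assms
proof (induction g)
  case (Cons s g)
  have "set (next_start g es) \<subseteq> set (plan_nodes g) \<union> set es"
    by (cases g) (auto simp: fst_in_seg_nodes)
  then have y: "(\<lambda>w. y w i) \<in> borel_measurable M" if "i \<in> set (seg_nodes s) \<union> set (next_start g es)" for i
    using that Cons.prems by auto
  obtain a ts d where s: "s = (a, ts, d)" by (cases s)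
  have t: "(\<lambda>w. path_length T (map (y w) (a # ts @ next_start g es))) \<in> borel_measurable M"
    by (intro path_length_measurable T_D_measurable y) (auto simp: s seg_nodes_def)
  have "(\<lambda>w. leg (y w) s (next_start g es)) \<in> borel_measurable M"
  proof (cases d)
    case None
    then show ?thesis using t unfolding leg_def s prod.case option.case None by (intro borel_measurable_max) auto
  next
    case (Some p)
    have "(\<lambda>w. path_length D (map (y w) (a # p # next_start g es))) \<in> borel_measurable M"
      by (intro path_length_measurable T_D_measurable y) (auto simp: s Some)
    then show ?thesis using t unfolding leg_def s prod.case option.case Some by (intro borel_measurable_max) auto
  qed
  then show ?case using Cons by auto
qed simp

lemma opt_measurable:
  assumes "finite I" "\<And>i. i \<in> I \<Longrightarrow> (\<lambda>w. y w i) \<in> borel_measurable M"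
  shows "(\<lambda>w. opt (y w) I) \<in> borel_measurable (M :: 'w measure)"
  unfolding opt_def
  by (intro borel_measurable_Min finite_plans assms(1) plan_cost_measurable) (use assms(2) in \<open>auto simp: plans_def\<close>)

definition opt_square :: "('i \<Rightarrow> real^2) \<Rightarrow> 'i set \<Rightarrow> real" where
  "opt_square x I = opt (clamp_square \<circ> x) I"

lemma opt_square_measurable:
  assumes "finite J" "I \<subseteq> J"
  shows "(\<lambda>x. opt_square x I) \<in> borel_measurable (PiM J (\<lambda>_. unit_square_measure))"
  unfolding opt_square_def
proof (rule opt_measurable)
  show "finite I" using assms finite_subset by blast
  fix i assume "i \<in> I"
  then have "(\<lambda>x. x i) \<in> measurable (PiM J (\<lambda>_. unit_square_measure)) borel"
    using assms(2) measurable_component_singleton[of i J "\<lambda>_. unit_square_measure"]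
    by (auto cong: measurable_cong_sets)
  from measurable_compose[OF this clamp_square_measurable]
  show "(\<lambda>x. (clamp_square \<circ> x) i) \<in> borel_measurable (PiM J (\<lambda>_. unit_square_measure))" by simp
qed

lemma opt_square_nonneg: "finite I \<Longrightarrow> 0 \<le> opt_square x I"
  unfolding opt_square_def by (rule opt_nonneg)

lemma opt_square_upper: "finite I \<Longrightarrow> opt_square x I \<le> 16 * B * sqrt (card I)"
  unfolding opt_square_def by (rule opt_upper) (simp_all add: clamp_square_mem)

lemma opt_square_smooth:
  "finite I \<Longrightarrow> finite J \<Longrightarrow> \<bar>opt_square x I - opt_square x J\<bar> \<le> L * sqrt (card ((I - J) \<union> (J - I)))"
  unfolding opt_square_def by (rule opt_smooth) (simp_all add: clamp_square_mem)

lemma opt_square_cong: "(\<And>i. i \<in> I \<Longrightarrow> x i = y i) \<Longrightarrow> opt_square x I = opt_square y I"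
  unfolding opt_square_def by (rule opt_cong) simp

lemma opt_square_integrable:
  assumes "finite J" "I \<subseteq> J"
  shows "integrable (PiM J (\<lambda>_. unit_square_measure)) (\<lambda>x. opt_square x I)"
proof -
  interpret PI: prob_space "PiM J (\<lambda>_. unit_square_measure)"
    by (rule prob_space_PiM) (rule prob_space_unit_square)
  have "finite I" using assms finite_subset by blast
  then have "norm (opt_square x I) \<le> 16 * B * sqrt (card I)" for x
    using opt_square_nonneg[of I x] opt_square_upper[of I x] by simp
  then show ?thesis
    using assms by (intro PI.integrable_const_bound[of _ "16 * B * sqrt (card I)"] opt_square_measurable) auto
qed

section \<open>The mean cost of uniform points\<close>

definition avg :: "nat \<Rightarrow> real" where
  "avg n = (\<integral>x. opt_square x {..<n} \<partial>PiM {..<n} (\<lambda>_. unit_square_measure))"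

text \<open>The coordinates in \<open>I\<close>, renumbered by a bijection, are again independent
  and uniform, and \<open>opt\<close> is invariant under renumbering. This applies in particular to
  the random-looking subset of indices that a labeling assigns to one cell.\<close>

lemma avg_card:
  fixes J :: "'i set"
  assumes "finite J" "I \<subseteq> J"
  shows "(\<integral>x. opt_square x I \<partial>PiM J (\<lambda>_. unit_square_measure)) = avg (card I)"
proof -
  have "finite I" using assms finite_subset by blast
  then obtain f where f: "bij_betw f {0..<card I} I" using ex_bij_betw_nat_finite by blast
  then have f: "inj_on f {..<card I}" "f ` {..<card I} = I"
    by (simp_all add: bij_betw_def atLeast0LessThan)
  let ?U = "\<lambda>_. unit_square_measure" and ?K = "{..<card I}"
  let ?t = "\<lambda>x. \<lambda>n\<in>?K. x (f n)"
  have distr: "distr (PiM J ?U) (PiM ?K ?U) ?t = PiM ?K ?U"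
    using f assms(2) by (intro distr_PiM_reindex prob_space_unit_square) auto
  have t: "?t \<in> measurable (PiM J ?U) (PiM ?K ?U)"
    using f(2) assms(2) by (intro measurable_restrict measurable_component_singleton) auto
  have "avg (card I) = (\<integral>x. opt_square x ?K \<partial>distr (PiM J ?U) (PiM ?K ?U) ?t)"
    unfolding avg_def distr ..
  also have "\<dots> = (\<integral>x. opt_square (?t x) ?K \<partial>PiM J ?U)"
    by (rule integral_distr[OF t opt_square_measurable]) auto
  also have "\<dots> = (\<integral>x. opt_square x I \<partial>PiM J ?U)"
  proof (rule Bochner_Integration.integral_cong[OF refl])
    fix x :: "'i \<Rightarrow> real^2"
    have "opt_square (?t x) ?K = opt_square (x \<circ> f) ?K" by (rule opt_square_cong) simp
    also have "\<dots> = opt_square x (f ` ?K)"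
      unfolding opt_square_def using opt_image[of ?K f "clamp_square \<circ> x"] f(1) by (simp add: comp_assoc)
    finally show "opt_square (?t x) ?K = opt_square x I" using f(2) by simp
  qed
  finally show ?thesis by simp
qed

lemma avg_nonneg: "0 \<le> avg n"
  unfolding avg_def by (intro integral_nonneg_AE AE_I2 opt_square_nonneg) simp

text \<open>Both means are computed from the same \<open>n\<close> points, the smaller one using the
  first \<open>k\<close> of them, so the pointwise smoothness bound can be integrated.\<close>

lemma avg_smooth:
  assumes "k \<le> n"
  shows "\<bar>avg n - avg k\<bar> \<le> L * sqrt (real n - real k)"
proof -
  let ?P = "PiM {..<n} (\<lambda>_. unit_square_measure)"
  interpret PI: prob_space ?P by (rule prob_space_PiM) (rule prob_space_unit_square)
  have sub: "{..<k} \<subseteq> {..<n}" using assms by auto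
  note int = opt_square_integrable[OF finite_lessThan sub] opt_square_integrable[OF finite_lessThan subset_refl]
  have "\<bar>opt_square x {..<n} - opt_square x {..<k}\<bar> \<le> L * sqrt (real n - real k)" for x :: "nat \<Rightarrow> real^2"
  proof -
    have "({..<n} - {..<k}) \<union> ({..<k} - {..<n}) = {k..<n}" using assms by auto
    then show ?thesis using opt_square_smooth[of "{..<n}" "{..<k}" x] assms by (simp add: of_nat_diff)
  qed
  then have "(\<integral>x. norm (opt_square x {..<n} - opt_square x {..<k}) \<partial>?P) \<le> (\<integral>x. L * sqrt (real n - real k) \<partial>?P)"
    using int by (intro integral_mono) auto
  moreover have "avg n - avg k = (\<integral>x. opt_square x {..<n} - opt_square x {..<k} \<partial>?P)"
    using avg_card[of "{..<n}" "{..<n}"] avg_card[OF finite_lessThan sub] int by simp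
  then have "norm (avg n - avg k) \<le> (\<integral>x. norm (opt_square x {..<n} - opt_square x {..<k}) \<partial>?P)"
    by simp
  ultimately show ?thesis by (simp add: PI.prob_space)
qed

text \<open>Smoothness gives an error \<open>L * sqrt d\<close> with \<open>d\<close> the distance
  of \<open>c\<close> from \<open>l\<close>, whereas second moments of cell counts are what is
  available. With \<open>s = sqrt l\<close>, the ratio \<open>d / s\<close> is either at most 1, or
  its square root is at most its square; this yields a bound that is linear in
  \<open>d\<^sup>2\<close>.\<close>

lemma avg_le_deviation:
  assumes "1 \<le> l"
  shows "avg c \<le> avg l + L * sqrt (sqrt l) * (1 + (real c - real l)\<^sup>2 / l)"
proof -
  define s where "s = sqrt (real l)"
  have s: "0 < s" "real l = s * s" using assms by (simp_all add: s_def)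
  define d where "d = \<bar>real c - real l\<bar>"
  have "\<bar>avg c - avg l\<bar> \<le> L * sqrt d"
    using avg_smooth[of c l] avg_smooth[of l c] by (cases "c \<le> l") (auto simp: d_def abs_minus_commute)
  moreover have "sqrt d \<le> sqrt s * (1 + d\<^sup>2 / (s * s))"
  proof (cases "d \<le> s")
    case True
    have "sqrt d \<le> sqrt s * 1" using True by simp
    also have "\<dots> \<le> sqrt s * (1 + d\<^sup>2 / (s * s))" using s by (intro mult_left_mono) auto
    finally show ?thesis .
  next
    case False
    then have q: "1 \<le> d / s" using s by simp
    have "sqrt d = sqrt s * sqrt (d / s)" using s by (simp add: real_sqrt_divide)
    also have "\<dots> \<le> sqrt s * (1 + d\<^sup>2 / (s * s))"
    proof (rule mult_left_mono)
      have "d / s \<le> ((d / s)\<^sup>2)\<^sup>2"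
        using q self_le_power[of "d / s" 4] unfolding power_mult[symmetric] by simp
      then have "sqrt (d / s) \<le> (d / s)\<^sup>2" by (intro real_le_lsqrt) auto
      also have "\<dots> = d\<^sup>2 / (s * s)" by (simp add: power2_eq_square)
      finally show "sqrt (d / s) \<le> 1 + d\<^sup>2 / (s * s)" by simp
    qed (use s in simp)
    finally show ?thesis .
  qed
  then have "L * sqrt d \<le> L * (sqrt s * (1 + d\<^sup>2 / (s * s)))" using L_pos by (intro mult_left_mono) auto
  ultimately have "avg c \<le> avg l + L * (sqrt s * (1 + d\<^sup>2 / (s * s)))" by linarith
  then show ?thesis unfolding d_def power2_abs s_def[symmetric] s(2)[symmetric] by (simp add: mult.assoc)
qed

text \<open>The path through the at most \<open>m * m\<close> occupied cells costs
  \<open>16 * B * m\<close>. Each cell has \<open>T\<close>-diameter at most \<open>B / m\<close>,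
  and two diameters per cell add \<open>2 * B * m\<close>. Inside a cell the problem is a copy of
  the original one scaled by \<open>1 / m\<close>.\<close>

lemma opt_square_grid:
  assumes m: "1 \<le> m" and I: "finite I" and \<sigma>: "\<sigma> \<in> I \<rightarrow> cells m"
  shows "opt_square (\<lambda>i\<in>I. place m (\<sigma> i) (x i)) I
    \<le> (\<Sum>q\<in>cells m. 1 / real m * opt_square x {i \<in> I. \<sigma> i = q}) + 18 * B * m"
proof -
  let ?y = "\<lambda>i. place m (\<sigma> i) (x i)"
  have y: "?y i \<in> cbox 0 1" if "i \<in> I" for i by (rule place_mem[OF m funcset_mem[OF \<sigma> that]])
  have "opt_square (\<lambda>i\<in>I. ?y i) I = opt ?y I"
    unfolding opt_square_def by (rule opt_cong) (simp add: clamp_square_eq y)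
  also have "\<dots> \<le> (\<Sum>q\<in>\<sigma> ` I. opt ?y {i \<in> I. \<sigma> i = q}) + 16 * B * sqrt (card (\<sigma> ` I))
    + 2 * (B / m) * card (\<sigma> ` I)"
  proof (rule opt_grid[OF I y])
    fix i j assume "i \<in> I" "j \<in> I" "\<sigma> i = \<sigma> j"
    then have "?y i - ?y j = (1 / real m) *\<^sub>R (clamp_square (x i) - clamp_square (x j))"
      by (simp add: place_def scaleR_diff_right)
    then show "T (?y i - ?y j) \<le> B / m"
      using T_le_cube[OF clamp_square_mem clamp_square_mem, of "x i" "x j"] m
      by (simp add: T_scale divide_right_mono)
  qed (use B_pos in \<open>auto intro!: divide_nonneg_nonneg\<close>)
  also have "\<dots> \<le> (\<Sum>q\<in>cells m. 1 / real m * opt_square x {i \<in> I. \<sigma> i = q}) + 16 * B * m + 2 * B * m"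
  proof (intro add_mono)
    have sub: "\<sigma> ` I \<subseteq> cells m" by (rule image_subsetI) (rule funcset_mem[OF \<sigma>])
    have eq: "opt ?y {i \<in> I. \<sigma> i = q} = 1 / real m * opt_square x {i \<in> I. \<sigma> i = q}" for q
    proof -
      have "opt ?y {i \<in> I. \<sigma> i = q} = opt (\<lambda>i. (1 / real m) *\<^sub>R (clamp_square \<circ> x) i + corner m q) {i \<in> I. \<sigma> i = q}"
        by (rule opt_cong) (simp add: place_def)
      also have "\<dots> = 1 / real m * opt_square x {i \<in> I. \<sigma> i = q}"
        unfolding opt_square_def using I by (intro opt_scale) auto
      finally show ?thesis .
    qed
    show "(\<Sum>q\<in>\<sigma> ` I. opt ?y {i \<in> I. \<sigma> i = q}) \<le> (\<Sum>q\<in>cells m. 1 / real m * opt_square x {i \<in> I. \<sigma> i = q})"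
      unfolding eq using sub I by (intro sum_mono2) (auto intro!: divide_nonneg_nonneg opt_square_nonneg)
    have c: "card (\<sigma> ` I) \<le> m * m" using card_mono[OF _ sub] by simp
    then have cr: "real (card (\<sigma> ` I)) \<le> real m * real m" by (metis of_nat_le_iff of_nat_mult)
    then have "sqrt (card (\<sigma> ` I)) \<le> m" using real_sqrt_le_mono[OF cr] by simp
    then show "16 * B * sqrt (card (\<sigma> ` I)) \<le> 16 * B * m" using B_pos by (intro mult_left_mono) auto
    have "2 * (B / m) * card (\<sigma> ` I) \<le> 2 * (B / m) * (real m * real m)"
      using cr B_pos by (intro mult_left_mono) auto
    then show "2 * (B / m) * card (\<sigma> ` I) \<le> 2 * B * m" using m by simp
  qed
  finally show ?thesis by (simp add: algebra_simps)
qed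

text \<open>The grid bound is averaged over all labelings. A cell holds \<open>l\<close> points on
  average with variance at most \<open>l\<close>, so both summands of the factor
  \<open>1 + (c - l)\<^sup>2 / l\<close> contribute at most 1 on average; this is the origin of
  \<open>2 * L\<close>.\<close>

lemma avg_grid:
  assumes m: "1 \<le> m" and l: "1 \<le> l"
  shows "avg (m\<^sup>2 * l) \<le> m * (avg l + (2 * L + 18 * B) * sqrt (sqrt l))"
proof -
  define n where "n = m\<^sup>2 * l"
  let ?I = "{..<n}"
  let ?P = "PiM ?I (\<lambda>_. unit_square_measure)" and ?S = "PiE ?I (\<lambda>_. cells m)"
  define w where "w = 1 / (real m)\<^sup>2"
  define R where "R \<sigma> = (\<Sum>q\<in>cells m. 1 / real m * avg (card {i \<in> ?I. \<sigma> i = q})) + 18 * B * m" for \<sigma>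
  interpret PI: prob_space ?P by (rule prob_space_PiM) (rule prob_space_unit_square)
  have R0: "0 \<le> R \<sigma>" for \<sigma>
    unfolding R_def using B_pos avg_nonneg by (intro add_nonneg_nonneg sum_nonneg mult_nonneg_nonneg) auto
  have "ennreal (avg n) = (\<integral>\<^sup>+x. opt_square x ?I \<partial>?P)"
    unfolding avg_def using opt_square_integrable[of ?I ?I]
    by (intro nn_integral_eq_integral[symmetric] AE_I2 opt_square_nonneg) auto
  also have "\<dots> \<le> ennreal w ^ card ?I * (\<Sum>\<sigma>\<in>?S. \<integral>\<^sup>+x. opt_square (\<lambda>i\<in>?I. place m (\<sigma> i) (x i)) ?I \<partial>?P)"
    unfolding w_def
  proof (rule nn_integral_PiM_mixture[OF prob_space_unit_square])
    show "(\<lambda>x. ennreal (opt_square x ?I)) \<in> borel_measurable ?P"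
      using opt_square_measurable[of ?I ?I] by simp
    show "place m q \<in> measurable unit_square_measure unit_square_measure" for q
      by (simp cong: measurable_cong_sets)
    fix h :: "real^2 \<Rightarrow> ennreal" assume "h \<in> borel_measurable unit_square_measure"
    then show "(\<integral>\<^sup>+y. h y \<partial>unit_square_measure)
      \<le> ennreal (1 / (real m)\<^sup>2) * (\<Sum>q\<in>cells m. \<integral>\<^sup>+y. h (place m q y) \<partial>unit_square_measure)"
      by (intro unit_square_mixture[OF m]) (simp cong: measurable_cong_sets)
  qed simp
  also have "\<dots> \<le> ennreal w ^ card ?I * (\<Sum>\<sigma>\<in>?S. ennreal (R \<sigma>))"
  proof (intro mult_left_mono sum_mono)
    fix \<sigma> assume "\<sigma> \<in> ?S"
    then have \<sigma>: "\<sigma> \<in> ?I \<rightarrow> cells m" by auto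
    let ?F = "\<lambda>x. (\<Sum>q\<in>cells m. 1 / real m * opt_square x {i \<in> ?I. \<sigma> i = q}) + 18 * B * m"
    have int: "integrable ?P (\<lambda>x. opt_square x {i \<in> ?I. \<sigma> i = q})" for q
      by (rule opt_square_integrable) auto
    have F0: "0 \<le> ?F x" for x
      using B_pos by (intro add_nonneg_nonneg sum_nonneg mult_nonneg_nonneg opt_square_nonneg) auto
    have "(\<integral>\<^sup>+x. opt_square (\<lambda>i\<in>?I. place m (\<sigma> i) (x i)) ?I \<partial>?P) \<le> (\<integral>\<^sup>+x. ?F x \<partial>?P)"
      by (intro nn_integral_mono ennreal_leI opt_square_grid m \<sigma>) simp
    also have "\<dots> = ennreal (\<integral>x. ?F x \<partial>?P)"
      using int F0 by (intro nn_integral_eq_integral) auto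
    \<comment> \<open>For a fixed labeling the points assigned to a cell, before being placed there,
      are independent and uniform in the whole square, so only their number enters.\<close>
    also have "(\<integral>x. ?F x \<partial>?P) = R \<sigma>"
    proof -
      have "(\<integral>x. opt_square x {i \<in> ?I. \<sigma> i = q} \<partial>?P) = avg (card {i \<in> ?I. \<sigma> i = q})" for q
        by (rule avg_card) auto
      then have E: "(\<integral>x. 1 / real m * opt_square x {i \<in> ?I. \<sigma> i = q} \<partial>?P)
        = 1 / real m * avg (card {i \<in> ?I. \<sigma> i = q})" for q
        by (simp only: integral_mult_right_zero)
      have "(\<integral>x. (\<Sum>q\<in>cells m. 1 / real m * opt_square x {i \<in> ?I. \<sigma> i = q}) \<partial>?P)
        = (\<Sum>q\<in>cells m. \<integral>x. 1 / real m * opt_square x {i \<in> ?I. \<sigma> i = q} \<partial>?P)"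
        using int by (intro Bochner_Integration.integral_sum) auto
      then have "(\<integral>x. (\<Sum>q\<in>cells m. 1 / real m * opt_square x {i \<in> ?I. \<sigma> i = q}) \<partial>?P)
        = (\<Sum>q\<in>cells m. 1 / real m * avg (card {i \<in> ?I. \<sigma> i = q}))"
        by (simp only: E)
      moreover have "(\<integral>x. ?F x \<partial>?P)
        = (\<integral>x. (\<Sum>q\<in>cells m. 1 / real m * opt_square x {i \<in> ?I. \<sigma> i = q}) \<partial>?P) + (\<integral>x. 18 * B * m \<partial>?P)"
        using int by (intro Bochner_Integration.integral_add) auto
      ultimately show ?thesis by (simp add: R_def PI.prob_space)
    qed
    finally show "(\<integral>\<^sup>+x. opt_square (\<lambda>i\<in>?I. place m (\<sigma> i) (x i)) ?I \<partial>?P) \<le> ennreal (R \<sigma>)" .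
  qed simp
  also have "\<dots> = ennreal (w ^ n * (\<Sum>\<sigma>\<in>?S. R \<sigma>))"
    using R0 by (simp add: w_def ennreal_mult sum_nonneg ennreal_power sum_ennreal)
  finally have main: "avg n \<le> w ^ n * (\<Sum>\<sigma>\<in>?S. R \<sigma>)"
    using R0 by (subst (asm) ennreal_le_iff) (auto intro!: mult_nonneg_nonneg sum_nonneg simp: w_def)
  define s where "s = sqrt (sqrt l)"
  have s: "1 \<le> s" using l by (simp add: s_def)
  define N where "N = (real (card (cells m)))"
  have N: "N = (real m)\<^sup>2" "0 < N" using m by (simp_all add: N_def power2_eq_square)
  have cS: "real (card ?S) = N ^ n" by (simp add: card_PiE N_def)
  have cell_sum: "(\<Sum>\<sigma>\<in>?S. avg (card {i \<in> ?I. \<sigma> i = q})) \<le> N ^ n * (avg l + 2 * L * s)" if q: "q \<in> cells m" for q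
  proof -
    \<comment> \<open>The mean occupancy \<open>n / N\<close> of a cell equals \<open>l\<close>, so
      the deviation is a sum of centred indicators.\<close>
    have dev: "real (card {i \<in> ?I. \<sigma> i = q}) - real l = (\<Sum>i\<in>?I. of_bool (\<sigma> i = q) - 1 / N)" for \<sigma> :: "nat \<Rightarrow> nat \<times> nat"
    proof -
      have "(\<Sum>i\<in>?I. of_bool (\<sigma> i = q)) = real (card {i \<in> ?I. \<sigma> i = q})"
        by (simp add: sum_of_bool_eq Int_def)
      moreover have "real n * (1 / N) = l" using m by (simp add: n_def N)
      ultimately show ?thesis by (simp add: sum_subtractf)
    qed
    have var: "(\<Sum>\<sigma>\<in>?S. (real (card {i \<in> ?I. \<sigma> i = q}) - real l)\<^sup>2) \<le> N ^ n * l"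
      using labeling_variance[of "cells m" q ?I] q m unfolding dev N_def[symmetric]
      by (simp add: n_def N)
    have "(\<Sum>\<sigma>\<in>?S. avg (card {i \<in> ?I. \<sigma> i = q}))
      \<le> (\<Sum>\<sigma>\<in>?S. (avg l + L * s) + (L * s / l) * (real (card {i \<in> ?I. \<sigma> i = q}) - real l)\<^sup>2)"
    proof (rule sum_mono)
      fix \<sigma> :: "nat \<Rightarrow> nat \<times> nat"
      show "avg (card {i \<in> ?I. \<sigma> i = q}) \<le> (avg l + L * s) + (L * s / l) * (real (card {i \<in> ?I. \<sigma> i = q}) - real l)\<^sup>2"
        using avg_le_deviation[OF l, of "card {i \<in> ?I. \<sigma> i = q}"] unfolding s_def by (simp add: distrib_left)
    qed
    also have "\<dots> = N ^ n * (avg l + L * s) + (L * s / l) * (\<Sum>\<sigma>\<in>?S. (real (card {i \<in> ?I. \<sigma> i = q}) - real l)\<^sup>2)"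
      by (simp only: sum.distrib sum_distrib_left[symmetric] sum_constant cS) (simp add: distrib_left)
    also have "\<dots> \<le> N ^ n * (avg l + L * s) + (L * s / l) * (N ^ n * l)"
      using L_pos s by (intro add_left_mono mult_left_mono[OF var]) auto
    also have "\<dots> = N ^ n * (avg l + 2 * L * s)" using l by (simp add: algebra_simps)
    finally show ?thesis .
  qed
  have "(\<Sum>\<sigma>\<in>?S. R \<sigma>) = (\<Sum>q\<in>cells m. 1 / real m * (\<Sum>\<sigma>\<in>?S. avg (card {i \<in> ?I. \<sigma> i = q}))) + N ^ n * (18 * B * m)"
  proof -
    have "(\<Sum>\<sigma>\<in>?S. \<Sum>q\<in>cells m. 1 / real m * avg (card {i \<in> ?I. \<sigma> i = q}))
      = (\<Sum>q\<in>cells m. \<Sum>\<sigma>\<in>?S. 1 / real m * avg (card {i \<in> ?I. \<sigma> i = q}))" by (rule sum.swap)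
    then show ?thesis unfolding R_def by (simp only: sum.distrib sum_constant cS sum_distrib_left)
  qed
  also have "\<dots> \<le> (\<Sum>q\<in>cells m. 1 / real m * (N ^ n * (avg l + 2 * L * s))) + N ^ n * (18 * B * m)"
    by (intro add_right_mono sum_mono mult_left_mono cell_sum) auto
  also have "\<dots> = N * (1 / real m * (N ^ n * (avg l + 2 * L * s))) + N ^ n * (18 * B * m)"
    by (simp only: sum_constant N_def)
  also have "\<dots> = N ^ n * (m * (avg l + 2 * L * s) + 18 * B * m)"
    using m by (simp add: N(1) power2_eq_square algebra_simps)
  finally have "w ^ n * (\<Sum>\<sigma>\<in>?S. R \<sigma>) \<le> w ^ n * (N ^ n * (m * (avg l + 2 * L * s) + 18 * B * m))"
    by (intro mult_left_mono) (auto simp: w_def)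
  also have "w ^ n * (N ^ n * (m * (avg l + 2 * L * s) + 18 * B * m)) = m * (avg l + 2 * L * s) + 18 * B * m"
    using m by (simp add: w_def N mult.assoc[symmetric] power_mult_distrib[symmetric])
  \<comment> \<open>The linking cost \<open>18 * B * m\<close> is absorbed into the other error term
    by means of \<open>s \<ge> 1\<close>.\<close>
  also have "\<dots> \<le> m * (avg l + (2 * L + 18 * B) * s)"
    using s B_pos mult_left_mono[OF s, of "m * (18 * B)"] by (simp add: algebra_simps)
  finally show ?thesis using main unfolding n_def s_def by linarith
qed

lemma avg_limit: "\<exists>\<beta>. (\<lambda>n. avg n / sqrt n) \<longlonglongrightarrow> \<beta>"
proof (rule quasi_subadditive_limit)
  show "avg n \<le> avg k + L * sqrt (real n - real k)" if "k \<le> n" for n k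
    using avg_smooth[OF that] by linarith
qed (use avg_nonneg avg_grid L_pos B_pos in auto)

text \<open>McDiarmid's inequality is applied to the regularized functional \<open>G\<close>, whose
  differences are uniformly small, and the result is carried back to the original
  functional.\<close>

lemma opt_square_concentration:
  assumes n: "1 \<le> n" and e: "0 < e"
  defines "P \<equiv> PiM {..<n} (\<lambda>_. unit_square_measure)"
  shows "measure P {x \<in> space P. e * sqrt n \<le> \<bar>opt_square x {..<n} - avg n\<bar>}
    \<le> 2 * exp (- (e ^ 4 / (32 * L ^ 4)) * n)"
proof -
  let ?A = "{..<n}"
  interpret P: prob_space P unfolding P_def by (rule prob_space_PiM) (rule prob_space_unit_square)
  \<comment> \<open>Chosen so that the regularization error \<open>L\<^sup>2 / (4 * c)\<close> is
    \<open>e * sqrt n / 4\<close>.\<close>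
  define c where "c = L\<^sup>2 / (e * sqrt n)"
  have c: "0 < c" using L_pos e n by (simp add: c_def)
  define G where "G x = lower_reg c (upper_reg c (opt_square x)) ?A" for x :: "nat \<Rightarrow> real^2"
  have close: "\<bar>G x - opt_square x ?A\<bar> \<le> e * sqrt n / 4" for x
  proof -
    have "\<bar>G x - opt_square x ?A\<bar> \<le> L\<^sup>2 / (4 * c)"
      unfolding G_def
    proof (rule lower_upper_reg_close)
      fix K J assume KJ: "K \<subseteq> J" "J \<subseteq> ?A"
      then have "finite J" "finite K" by (meson finite_lessThan finite_subset)+
      moreover have "(J - K) \<union> (K - J) = J - K" using KJ by auto
      ultimately show "\<bar>opt_square x J - opt_square x K\<bar> \<le> L * sqrt (card (J - K))"
        using opt_square_smooth[of J K x] by simp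
    qed (use c in auto)
    also have "\<dots> = e * sqrt n / 4" using L_pos e n by (simp add: c_def)
    finally show ?thesis .
  qed
  have G_meas: "G \<in> borel_measurable P"
    unfolding G_def P_def by (intro lower_upper_reg_measurable opt_square_measurable) auto
  have G_bound: "\<bar>G x\<bar> \<le> 16 * B * sqrt n + e * sqrt n / 4" for x
    using close[of x] opt_square_nonneg[OF finite_lessThan, of x n]
      opt_square_upper[OF finite_lessThan, of x n]
    unfolding card_lessThan by linarith
  \<comment> \<open>Moving point \<open>i\<close> is a deletion followed by an insertion: both
    values are compared with the functional on the other indices, which does not see coordinate
    \<open>i\<close>. Each comparison costs \<open>c\<close>.\<close>
  have G_diff: "\<bar>G (x(i := y)) - G x\<bar> \<le> 2 * c" if "i \<in> ?A" for x i y
  proof -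
    let ?H = "\<lambda>x. lower_reg c (upper_reg c (opt_square x)) (?A - {i})"
    have "?H (x(i := y)) = ?H x" by (intro lower_upper_reg_cong opt_square_cong) auto
    moreover have "\<bar>G x - ?H x\<bar> \<le> c" "\<bar>G (x(i := y)) - ?H (x(i := y))\<bar> \<le> c"
      unfolding G_def using that c by (intro lower_upper_reg_remove; simp)+
    ultimately show ?thesis by linarith
  qed
  have int: "integrable P G" "integrable P (\<lambda>x. opt_square x ?A)"
  proof -
    show "integrable P G"
      using G_meas G_bound by (intro P.integrable_const_bound[of _ "16 * B * sqrt n + e * sqrt n / 4"]) auto
    show "integrable P (\<lambda>x. opt_square x ?A)" unfolding P_def by (rule opt_square_integrable) auto
  qed
  have "\<bar>integral\<^sup>L P G - avg n\<bar> \<le> e * sqrt n / 4"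
  proof -
    have "integral\<^sup>L P G - avg n = (\<integral>x. G x - opt_square x ?A \<partial>P)"
      using int by (simp add: avg_def P_def)
    also have "norm \<dots> \<le> (\<integral>x. norm (G x - opt_square x ?A) \<partial>P)" by (rule integral_norm_bound)
    also have "\<dots> \<le> (\<integral>x. e * sqrt n / 4 \<partial>P)" using int close by (intro integral_mono) auto
    finally show ?thesis by (simp add: P.prob_space)
  qed
  \<comment> \<open>A quarter of \<open>e * sqrt n\<close> is lost for the value and another quarter
    for the mean, which leaves half of the deviation.\<close>
  then have far: "e * sqrt n / 2 \<le> \<bar>G x - integral\<^sup>L P G\<bar>"
    if "e * sqrt n \<le> \<bar>opt_square x ?A - avg n\<bar>" for x
    using that close[of x] by linarith
  note [measurable] = G_meas
  have "measure P {x \<in> space P. e * sqrt n \<le> \<bar>opt_square x ?A - avg n\<bar>}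
    \<le> measure P {x \<in> space P. e * sqrt n / 2 \<le> \<bar>G x - integral\<^sup>L P G\<bar>}"
  proof (rule P.finite_measure_mono)
    show "{x \<in> space P. e * sqrt n / 2 \<le> \<bar>G x - integral\<^sup>L P G\<bar>} \<in> sets P" by measurable
  qed (use far in blast)
  also have "\<dots> \<le> 2 * exp (- (e * sqrt n / 2)\<^sup>2 / (2 * card ?A * (2 * c)\<^sup>2))"
  proof -
    have "0 \<in> ?A" using n by simp
    then have "?A \<noteq> {}" by blast
    then show ?thesis
      unfolding P_def using G_meas G_bound G_diff e n c
      by (intro McDiarmid_abs prob_space_unit_square) (auto simp: P_def)
  qed
  \<comment> \<open>Here \<open>c\<^sup>2 = L ^ 4 / (e\<^sup>2 * n)\<close> cancels the
    \<open>n\<close> from \<open>card ?A\<close>, so the exponent is linear in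
    \<open>n\<close>.\<close>
  also have "- (e * sqrt n / 2)\<^sup>2 / (2 * card ?A * (2 * c)\<^sup>2) = - (e ^ 4 / (32 * L ^ 4)) * n"
    using L_pos e n by (simp add: c_def power2_eq_square power4_eq_xxxx field_simps)
  finally show ?thesis .
qed

end

section \<open>Almost sure convergence\<close>

theorem theorem3:
  fixes T D :: "real^2 \<Rightarrow> real"
    and M :: "'w measure" and X :: "nat \<Rightarrow> 'w \<Rightarrow> real^2"
  assumes "is_norm T" and "is_norm D"
    and "\<And>p. D p \<le> T p"
    and "prob_space M"
    and "prob_space.indep_vars M (\<lambda>_. borel) X UNIV"
    and "\<And>i. distr M borel (X i) = uniform_measure lborel (cbox 0 1)"
  shows "\<exists>\<beta>::real. AE \<omega> in M.
           (\<lambda>n. TSPD T D ((\<lambda>i. X i \<omega>) ` {..<n}) / sqrt (real n)) \<longlonglongrightarrow> \<beta>"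
proof -
  interpret truck_drone T D using assms(1-3) by unfold_locales
  interpret prob_space M by (rule assms(4))
  let ?U = "unit_square_measure"
  have X [measurable]: "X i \<in> borel_measurable M" for i
    using assms(5) unfolding indep_vars_def by auto
  \<comment> \<open>The joint law of finitely many of the points is the product measure for which
    means and concentration were established.\<close>
  have law: "distr M (PiM I (\<lambda>_. borel)) (\<lambda>\<omega>. \<lambda>i\<in>I. X i \<omega>) = PiM I (\<lambda>_. ?U)" if "I \<noteq> {}" for I
  proof -
    have "indep_vars (\<lambda>_. borel) X I" using assms(5) by (rule indep_vars_subset) simp
    then show ?thesis using indep_vars_iff_distr_eq_PiM[OF that, where X = X and M' = "\<lambda>_. borel"] by (simp add: assms(6))
  qed
  have "AE x in ?U. x \<in> cbox 0 1"
    by (rule AE_uniform_measureI) auto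
  then have in_cube1: "AE \<omega> in M. X i \<omega> \<in> cbox 0 1" for i
    unfolding assms(6)[of i, symmetric] by (simp add: AE_distr_iff)
  then have in_cube: "AE \<omega> in M. \<forall>i. X i \<omega> \<in> cbox 0 1" by (simp add: AE_all_countable)
  \<comment> \<open>The makespan sees only the set of points, the functionals above their indices;
    the two agree once the points are distinct. By independence the pair has a product law, and by
    Fubini a coincidence has probability zero because singletons are null sets.\<close>
  have distinct2: "AE \<omega> in M. X i \<omega> \<noteq> X j \<omega>" if "i \<noteq> j" for i j
  proof -
    interpret U: prob_space ?U by (rule prob_space_unit_square)
    interpret UU: pair_prob_space ?U ?U ..
    have "AE y in ?U. x \<noteq> y" for x :: "real^2"
    proof (rule AE_uniform_measureI)
      show "AE y in lborel. y \<in> cbox 0 1 \<longrightarrow> x \<noteq> y"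
        using AE_lborel_singleton[of x] by eventually_elim auto
    qed simp
    then have "AE x in ?U. AE y in ?U. x \<noteq> y" by simp
    moreover have "{p \<in> space (?U \<Otimes>\<^sub>M ?U). fst p \<noteq> snd p} \<in> sets (?U \<Otimes>\<^sub>M ?U)" by measurable
    ultimately have ae: "AE p in ?U \<Otimes>\<^sub>M ?U. fst p \<noteq> snd p"
      using UU.AE_pair_measure[of "\<lambda>p. fst p \<noteq> snd p"] by simp
    have "indep_var borel ((\<lambda>x. x i) \<circ> (\<lambda>\<omega>. restrict (\<lambda>i. X i \<omega>) {i}))
      borel ((\<lambda>x. x j) \<circ> (\<lambda>\<omega>. restrict (\<lambda>i. X i \<omega>) {j}))"
      using that
      by (intro indep_var_compose[OF indep_var_restrict[OF assms(5)]] measurable_component_singleton) auto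
    then have "indep_var borel (X i) borel (X j)" by (simp add: comp_def)
    then have eq: "distr M (borel \<Otimes>\<^sub>M borel) (\<lambda>\<omega>. (X i \<omega>, X j \<omega>)) = ?U \<Otimes>\<^sub>M ?U"
      unfolding indep_var_distribution_eq by (simp add: assms(6))
    have "AE p in distr M (borel \<Otimes>\<^sub>M borel) (\<lambda>\<omega>. (X i \<omega>, X j \<omega>)). fst p \<noteq> snd p"
      unfolding eq by (rule ae)
    then show ?thesis by (subst (asm) AE_distr_iff) auto
  qed
  have distinct: "AE \<omega> in M. \<forall>i j. i \<noteq> j \<longrightarrow> X i \<omega> \<noteq> X j \<omega>"
    using distinct2 by (simp add: AE_all_countable)
  obtain \<beta> where \<beta>: "(\<lambda>n. avg n / sqrt n) \<longlonglongrightarrow> \<beta>" using avg_limit by blast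
  define f where "f n \<omega> = opt_square (\<lambda>i. X i \<omega>) {..<n}" for n \<omega>
  have f_meas [measurable]: "f n \<in> borel_measurable M" for n
    unfolding f_def opt_square_def by (intro opt_measurable) auto
  have conc: "AE \<omega> in M. \<forall>\<^sub>F n in sequentially. \<bar>f n \<omega> - avg n\<bar> < e * sqrt n" if e: "0 < e" for e
  proof -
    let ?E = "\<lambda>n. {\<omega> \<in> space M. e * sqrt n \<le> \<bar>f n \<omega> - avg n\<bar>}"
    have E: "measure M (?E n) \<le> 2 * exp (- (e ^ 4 / (32 * L ^ 4)) * n)" if n: "1 \<le> n" for n
    proof -
      let ?P = "PiM {..<n} (\<lambda>_. ?U)"
      let ?V = "\<lambda>\<omega>. \<lambda>i\<in>{..<n}. X i \<omega>"
      let ?F = "{x \<in> space ?P. e * sqrt n \<le> \<bar>opt_square x {..<n} - avg n\<bar>}"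
      have "0 \<in> {..<n}" using n by simp
      then have ne: "{..<n} \<noteq> {}" by blast
      have sets: "sets ?P = sets (PiM {..<n} (\<lambda>_. borel))" by (intro sets_PiM_cong) auto
      have F: "?F \<in> sets ?P" using opt_square_measurable[of "{..<n}" "{..<n}"] by measurable
      have V: "?V \<in> measurable M (PiM {..<n} (\<lambda>_. borel))" by measurable
      have fV: "opt_square (?V \<omega>) {..<n} = f n \<omega>" for \<omega>
        unfolding f_def by (rule opt_square_cong) simp
      have "measure ?P ?F = measure (distr M (PiM {..<n} (\<lambda>_. borel)) ?V) ?F" by (simp only: law[OF ne])
      also have "\<dots> = measure M (?V -` ?F \<inter> space M)" using V F sets by (intro measure_distr) auto
      also have "?V -` ?F \<inter> space M = ?E n"
        using measurable_space[OF V] fV by (auto simp: space_PiM)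
      finally show ?thesis using opt_square_concentration[OF n e] by simp
    qed
    have "summable (\<lambda>n. measure M (?E n))"
    proof (rule summable_comparison_test'[of _ 1])
      have "0 < e ^ 4 / (32 * L ^ 4)" using e L_pos by simp
      then have "exp (- (e ^ 4 / (32 * L ^ 4))) < 1" by simp
      then have "summable (\<lambda>n. 2 * exp (- (e ^ 4 / (32 * L ^ 4))) ^ n)"
        by (intro summable_mult summable_geometric) simp
      then show "summable (\<lambda>n. 2 * exp (- (e ^ 4 / (32 * L ^ 4)) * real n))"
        by (simp add: exp_of_nat_mult[symmetric] mult.commute)
    qed (use E in auto)
    then have "AE \<omega> in M. \<forall>\<^sub>F n in sequentially. \<omega> \<in> space M - ?E n"
      by (intro borel_cantelli_AE1) (auto simp: less_top[symmetric])
    then show ?thesis by eventually_elim (auto elim!: eventually_mono)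
  qed
  \<comment> \<open>Restricting \<open>e\<close> to the countably many values
    \<open>1 / Suc k\<close> allows one null set to serve for all of them.\<close>
  have "AE \<omega> in M. \<forall>k. \<forall>\<^sub>F n in sequentially. \<bar>f n \<omega> - avg n\<bar> < 1 / real (Suc k) * sqrt n"
    unfolding AE_all_countable by (intro allI conc) simp
  then have "AE \<omega> in M. (\<lambda>n. TSPD T D ((\<lambda>i. X i \<omega>) ` {..<n}) / sqrt (real n)) \<longlonglongrightarrow> \<beta>"
    using in_cube distinct
  proof eventually_elim
    case (elim \<omega>)
    have "(\<lambda>n. (f n \<omega> - avg n) / sqrt n) \<longlonglongrightarrow> 0"
    proof (rule tendstoI)
      fix e :: real assume "0 < e"
      then obtain k where k: "1 / real (Suc k) < e" using nat_approx_posE by blast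
      have "\<forall>\<^sub>F n in sequentially. \<bar>f n \<omega> - avg n\<bar> < 1 / real (Suc k) * sqrt n" using elim(1) by blast
      then show "\<forall>\<^sub>F n in sequentially. dist ((f n \<omega> - avg n) / sqrt n) 0 < e"
        using eventually_gt_at_top[of 0]
      proof eventually_elim
        case (elim n)
        then have "\<bar>f n \<omega> - avg n\<bar> / sqrt n < 1 / real (Suc k)" by (simp add: pos_divide_less_eq)
        then show ?case using k by simp
      qed
    qed
    from tendsto_add[OF this \<beta>] have f_lim: "(\<lambda>n. f n \<omega> / sqrt n) \<longlonglongrightarrow> \<beta>"
      by (simp add: diff_divide_distrib)
    \<comment> \<open>For this \<omega> all points lie in the square, so clamping has no effect, and
      they are distinct, so indices correspond to points. The additive constant \<open>3 * B\<close>
      disappears after division by \<open>sqrt n\<close>.\<close>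
    have near: "f n \<omega> \<le> TSPD T D ((\<lambda>i. X i \<omega>) ` {..<n})"
      "TSPD T D ((\<lambda>i. X i \<omega>) ` {..<n}) \<le> f n \<omega> + 3 * B" for n
    proof -
      let ?x = "\<lambda>i. X i \<omega>"
      have "inj_on ?x {..<n}" using elim(3) by (auto simp: inj_on_def)
      then have "opt id (?x ` {..<n}) = opt (id \<circ> ?x) {..<n}" by (intro opt_image) auto
      also have "\<dots> = f n \<omega>"
        unfolding f_def opt_square_def by (rule opt_cong) (use elim(2) in \<open>simp add: clamp_square_eq\<close>)
      finally show "f n \<omega> \<le> TSPD T D (?x ` {..<n})" "TSPD T D (?x ` {..<n}) \<le> f n \<omega> + 3 * B"
        using opt_le_TSPD[of "?x ` {..<n}"] TSPD_le_opt[of "?x ` {..<n}"] elim(2) by auto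
    qed
    have "(\<lambda>n. c / sqrt (real n)) \<longlonglongrightarrow> 0" for c :: real by real_asymp
    from tendsto_add[OF f_lim this[of "3 * B"]] have up_lim: "(\<lambda>n. (f n \<omega> + 3 * B) / sqrt n) \<longlonglongrightarrow> \<beta>"
      by (simp add: add_divide_distrib)
    show ?case
      by (rule tendsto_sandwich[OF _ _ f_lim up_lim])
         (auto intro!: always_eventually divide_right_mono near)
  qed
  then show ?thesis by blast
qed

end
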